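(* Let $n \geq 1$ and let $V_n \subseteq \mathbb{C}[x_1,\dots,x_{n+1}]$ be the $\mathbb{C}$-span of the polynomials $p(G)$ for $G$ ranging over slim subgraphs of $K_{n+1}$, with homogeneous components $V_n(k)$ (so $V_n = \bigoplus_{k\ge 0} V_n(k)$ is a graded $S_{n+1}$-module under permutation of variables). Embed $S_n$ into $S_{n+1}$ by letting $S_n$ act on the first $n$ letters. Then for every $k \geq 0$, \[ \mathrm{Res}^{S_{n+1}}_{S_n}(V_n(k)) \cong_{S_n} \bigoplus_D M^{\lambda(D)}, \] where the direct sum is over all Dyck paths $D$ of size $n$ with $\mathrm{area}(D) = k$. In particular, $\mathrm{Res}^{S_{n+1}}_{S_n}(V_n) \cong_{S_n} \mathrm{Park}_n$.
   Context: $K_{n+1}$ is the complete graph on vertex set $[n+1]=\{1,\dots,n+1\}$. For an edge $e=\{i<j\}$ set $p(e)=x_i-x_j$, and for a subgraph $G\subseteq K_{n+1}$ (identified with its edge set) set $p(G)=\prod_{e\in G}p(e)$. A subgraph $G$ is slim if the complementary edge set $K_{n+1}-G$ forms a connected graph on the vertex set $[n+1]$. $S_{n+1}$ acts on $\mathbb{C}[x_1,\dots,x_{n+1}]$ by permuting the variables. A Dyck path of size $n$ is a lattice path from $(0,0)$ to $(n,n)$ with unit steps $(0,1)$ (vertical) and $(1,0)$ (horizontal) staying weakly above the line $y=x$. A vertical run is a maximal contiguous sequence of vertical steps; the vertical run partition $\lambda(D)\vdash n$ lists the lengths of the vertical runs in weakly decreasing order. The area partition $\mu(D)$ is the partition with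 $n$ parts (zeros allowed) whose Ferrers diagram (English notation, placed in the upper left corner of the $n\times n$ square $[0,n]\times[0,n]$) is the set of unit boxes of that square lying to the upper left of $D$; $\mathrm{area}(D)=|\mu(D)|$. For a partition $\lambda=(\lambda_1,\dots,\lambda_k)\vdash n$, $S_\lambda=S_{\lambda_1}\times\cdots\times S_{\lambda_k}$ is the Young subgroup and $M^\lambda=\mathrm{Ind}_{S_\lambda}^{S_n}(\mathbf{1})$. A parking function of size $n$ is a sequence $(a_1,\dots,a_n)$ of positive integers whose nondecreasing rearrangement $b_1\le\dots\le b_n$ satisfies $b_i\le i$ for all $i$; $\mathrm{Park}_n$ is the $\mathbb{C}$-vector space with basis the parking functions of size $n$, with $S_n$ acting by $w.(a_1,\dots,a_n)=(a_{w(1)},\dots,a_{w(n)})$. *)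

theory Defs
  imports
    Complex_Main
    "HOL-Library.Poly_Mapping"
    "HOL-Library.Function_Algebras"
    "HOL-Library.Multiset"
    "HOL-Algebra.Sym_Groups"
begin

section \<open>Complex vector spaces\<close>

class complex_vector = ab_group_add +
  fixes scaleC :: "complex \<Rightarrow> 'a \<Rightarrow> 'a" (infixr \<open>*\<^sub>C\<close> 75)
  assumes scaleC_add_right: "c *\<^sub>C (u + v) = c *\<^sub>C u + c *\<^sub>C v"
    and scaleC_add_left: "(c + d) *\<^sub>C u = c *\<^sub>C u + d *\<^sub>C u"
    and scaleC_scaleC: "c *\<^sub>C (d *\<^sub>C u) = (c * d) *\<^sub>C u"
    and scaleC_one: "1 *\<^sub>C u = u"

interpretation cvec: vector_space "scaleC :: complex \<Rightarrow> 'a \<Rightarrow> 'a::complex_vector"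
  by unfold_locales (rule scaleC_add_right scaleC_add_left scaleC_scaleC scaleC_one)+

instantiation complex :: complex_vector
begin
definition scaleC_complex :: "complex \<Rightarrow> complex \<Rightarrow> complex"
  where "scaleC_complex c z = c * z"
instance
  by standard (simp_all add: scaleC_complex_def algebra_simps)
end

instantiation "fun" :: (type, complex_vector) complex_vector
begin
definition scaleC_fun :: "complex \<Rightarrow> ('a \<Rightarrow> 'b) \<Rightarrow> 'a \<Rightarrow> 'b"
  where "scaleC_fun c f = (\<lambda>x. c *\<^sub>C f x)"
instance
  by standard
    (auto simp: scaleC_fun_def scaleC_add_right scaleC_add_left scaleC_scaleC scaleC_one fun_eq_iff)
end

instantiation poly_mapping :: (type, complex_vector) complex_vector
begin
lift_definition scaleC_poly_mapping :: "complex \<Rightarrow> ('a \<Rightarrow>\<^sub>0 'b) \<Rightarrow> ('a \<Rightarrow>\<^sub>0 'b)"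
  is "\<lambda>c f x. c *\<^sub>C f x"
  by (erule finite_subset[rotated]) auto
instance
  by standard
    (transfer; simp add: scaleC_add_right scaleC_add_left scaleC_scaleC scaleC_one)+
end


section \<open>Linear representations\<close>

record ('g, 'v) rep =
  rgroup :: "'g monoid"
  rspace :: "'v set"
  ract :: "'g \<Rightarrow> 'v \<Rightarrow> 'v"

definition is_rep :: "('g, 'v::complex_vector) rep \<Rightarrow> bool" where
  "is_rep R \<longleftrightarrow>
     group (rgroup R) \<and> cvec.subspace (rspace R) \<and>
     (\<forall>g \<in> carrier (rgroup R).
        ract R g ` rspace R \<subseteq> rspace R \<and>
        (\<forall>u \<in> rspace R. \<forall>v \<in> rspace R. ract R g (u + v) = ract R g u + ract R g v) \<and>
        (\<forall>c. \<forall>v \<in> rspace R. ract R g (c *\<^sub>C v) = c *\<^sub>C ract R g v)) \<and>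
     (\<forall>v \<in> rspace R. ract R \<one>\<^bsub>rgroup R\<^esub> v = v) \<and>
     (\<forall>g \<in> carrier (rgroup R). \<forall>h \<in> carrier (rgroup R). \<forall>v \<in> rspace R.
        ract R (g \<otimes>\<^bsub>rgroup R\<^esub> h) v = ract R g (ract R h v))"

definition rep_iso ::
    "('g, 'v::complex_vector) rep \<Rightarrow> ('g, 'w::complex_vector) rep \<Rightarrow> bool" (infix \<open>\<cong>\<^sub>r\<close> 50) where
  "R \<cong>\<^sub>r S \<longleftrightarrow>
     is_rep R \<and> is_rep S \<and> rgroup R = rgroup S \<and>
     (\<exists>\<phi>. bij_betw \<phi> (rspace R) (rspace S) \<and>
        (\<forall>u \<in> rspace R. \<forall>v \<in> rspace R. \<phi> (u + v) = \<phi> u + \<phi> v) \<and>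
        (\<forall>c. \<forall>v \<in> rspace R. \<phi> (c *\<^sub>C v) = c *\<^sub>C \<phi> v) \<and>
        (\<forall>g \<in> carrier (rgroup R). \<forall>v \<in> rspace R. \<phi> (ract R g v) = ract S g (\<phi> v)))"

definition res_rep :: "'g set \<Rightarrow> ('g, 'v) rep \<Rightarrow> ('g, 'v) rep" where
  "res_rep H R = R\<lparr>rgroup := (rgroup R)\<lparr>carrier := H\<rparr>\<rparr>"

definition trivial_rep :: "'g monoid \<Rightarrow> ('g, complex) rep" where
  "trivial_rep G = \<lparr>rgroup = G, rspace = UNIV, ract = (\<lambda>g z. z)\<rparr>"

text \<open>
  Induction from a subgroup \<open>H\<close> (the group of \<open>R\<close>) to \<open>G\<close>, as the space of functions on \<open>G\<close> with
  \<open>f (h g) = h . f g\<close>, on which \<open>G\<close> acts by right translation. Functions are extended by zero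
  outside the carrier of \<open>G\<close>.
\<close>
definition ind_rep :: "'g monoid \<Rightarrow> ('g, 'v::complex_vector) rep \<Rightarrow> ('g, 'g \<Rightarrow> 'v) rep" where
  "ind_rep G R =
     \<lparr>rgroup = G,
      rspace = {f. (\<forall>x. x \<notin> carrier G \<longrightarrow> f x = 0) \<and> (\<forall>x \<in> carrier G. f x \<in> rspace R) \<and>
                   (\<forall>h \<in> carrier (rgroup R). \<forall>x \<in> carrier G. f (h \<otimes>\<^bsub>G\<^esub> x) = ract R h (f x))},
      ract = (\<lambda>g f x. if x \<in> carrier G then f (x \<otimes>\<^bsub>G\<^esub> g) else 0)\<rparr>"

text \<open>External direct sum; it is only used for finite index sets.\<close>
definition dsum_rep ::
    "'g monoid \<Rightarrow> 'i set \<Rightarrow> ('i \<Rightarrow> ('g, 'v::complex_vector) rep) \<Rightarrow> ('g, 'i \<Rightarrow> 'v) rep" where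
  "dsum_rep G I R =
     \<lparr>rgroup = G,
      rspace = {F. (\<forall>i \<in> I. F i \<in> rspace (R i)) \<and> (\<forall>i. i \<notin> I \<longrightarrow> F i = 0)},
      ract = (\<lambda>g F i. if i \<in> I then ract (R i) g (F i) else 0)\<rparr>"

definition internal_direct_sum :: "'v::complex_vector set \<Rightarrow> (nat \<Rightarrow> 'v set) \<Rightarrow> bool" where
  "internal_direct_sum V W \<longleftrightarrow>
     (\<forall>k. cvec.subspace (W k) \<and> W k \<subseteq> V) \<and>
     (\<forall>v \<in> V. \<exists>!c. (\<forall>k. c k \<in> W k) \<and> finite {k. c k \<noteq> 0} \<and> v = (\<Sum>k | c k \<noteq> 0. c k))"


section \<open>Polynomials and the action permuting variables\<close>

text \<open>
  Polynomials in variables indexed by \<open>nat\<close>; the ring in \<open>x\<^sub>1, \<dots>, x\<^sub>n\<^sub>+\<^sub>1\<close> is the subring using only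
  those variables.
\<close>
type_synonym cpoly = "(nat \<Rightarrow>\<^sub>0 nat) \<Rightarrow>\<^sub>0 complex"

definition var :: "nat \<Rightarrow> cpoly" where
  "var i = Poly_Mapping.single (Poly_Mapping.single i 1) 1"

definition monom_degree :: "(nat \<Rightarrow>\<^sub>0 nat) \<Rightarrow> nat" where
  "monom_degree m = (\<Sum>i \<in> Poly_Mapping.keys m. Poly_Mapping.lookup m i)"

definition homogeneous :: "nat \<Rightarrow> cpoly \<Rightarrow> bool" where
  "homogeneous k f \<longleftrightarrow> (\<forall>m \<in> Poly_Mapping.keys f. monom_degree m = k)"

text \<open>The additive extension of a map \<open>\<phi>\<close> of basis elements.\<close>
definition push :: "('a \<Rightarrow> 'b) \<Rightarrow> ('a \<Rightarrow>\<^sub>0 'c::comm_monoid_add) \<Rightarrow> ('b \<Rightarrow>\<^sub>0 'c)" where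
  "push \<phi> f = (\<Sum>a \<in> Poly_Mapping.keys f. Poly_Mapping.single (\<phi> a) (Poly_Mapping.lookup f a))"

text \<open>The substitution \<open>x\<^sub>i \<mapsto> x\<^bsub>w i\<^esub>\<close>: \<open>push w\<close> is its effect on exponent vectors.\<close>
definition permute_vars :: "(nat \<Rightarrow> nat) \<Rightarrow> cpoly \<Rightarrow> cpoly" where
  "permute_vars w f = push (push w) f"


section \<open>Slim subgraphs\<close>

definition complete_graph :: "nat \<Rightarrow> nat set set" where
  "complete_graph m = {e. e \<subseteq> {1..m} \<and> card e = 2}"

definition connected_on :: "'a set \<Rightarrow> 'a set set \<Rightarrow> bool" where
  "connected_on U E \<longleftrightarrow> (\<forall>u \<in> U. \<forall>v \<in> U. (u, v) \<in> {(a, b). {a, b} \<in> E}\<^sup>*)"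

definition slim :: "nat \<Rightarrow> nat set set \<Rightarrow> bool" where
  "slim n G \<longleftrightarrow> G \<subseteq> complete_graph (n + 1) \<and> connected_on {1..n + 1} (complete_graph (n + 1) - G)"

definition edge_poly :: "nat set \<Rightarrow> cpoly" where
  "edge_poly e = var (Min e) - var (Max e)"

definition graph_poly :: "nat set set \<Rightarrow> cpoly" where
  "graph_poly G = (\<Prod>e \<in> G. edge_poly e)"

definition slim_space :: "nat \<Rightarrow> cpoly set" where
  "slim_space n = cvec.span {graph_poly G | G. slim n G}"

definition slim_component :: "nat \<Rightarrow> nat \<Rightarrow> cpoly set" where
  "slim_component n k = {f \<in> slim_space n. homogeneous k f}"

definition slim_rep :: "nat \<Rightarrow> (nat \<Rightarrow> nat, cpoly) rep" where
  "slim_rep n = \<lparr>rgroup = sym_group (n + 1), rspace = slim_space n, ract = permute_vars\<rparr>"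

definition slim_component_rep :: "nat \<Rightarrow> nat \<Rightarrow> (nat \<Rightarrow> nat, cpoly) rep" where
  "slim_component_rep n k =
     \<lparr>rgroup = sym_group (n + 1), rspace = slim_component n k, ract = permute_vars\<rparr>"


section \<open>Dyck paths\<close>

datatype step = Vert | Horiz

definition endpoint :: "step list \<Rightarrow> nat \<times> nat" where
  "endpoint D = (count_list D Horiz, count_list D Vert)"

definition dyck_path :: "nat \<Rightarrow> step list \<Rightarrow> bool" where
  "dyck_path n D \<longleftrightarrow>
     endpoint D = (n, n) \<and>
     (\<forall>i \<le> length D. fst (endpoint (take i D)) \<le> snd (endpoint (take i D)))"

text \<open>A run is recorded as the half-open interval \<open>{i..<j}\<close> of the positions of its steps.\<close>
definition vertical_runs :: "step list \<Rightarrow> (nat \<times> nat) set" where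
  "vertical_runs D =
     {(i, j). i < j \<and> j \<le> length D \<and> (\<forall>l \<in> {i..<j}. D ! l = Vert) \<and>
              (i = 0 \<or> D ! (i - 1) = Horiz) \<and> (j = length D \<or> D ! j = Horiz)}"

definition run_partition :: "step list \<Rightarrow> nat list" where
  "run_partition D =
     rev (sorted_list_of_multiset {# j - i. (i, j) \<in># mset_set (vertical_runs D) #})"

text \<open>
  The pair \<open>(c, h)\<close> stands for the unit box \<open>[c, c + 1] \<times> [h, h + 1]\<close>; it lies to the upper left
  of \<open>D\<close> iff it lies to the left of the vertical step of \<open>D\<close> from height \<open>h\<close> to height \<open>h + 1\<close>.
\<close>
definition upper_left_boxes :: "step list \<Rightarrow> (nat \<times> nat) set" where
  "upper_left_boxes D =
     {(c, h). \<exists>i < length D. D ! i = Vert \<and>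
        c < fst (endpoint (take i D)) \<and> h = snd (endpoint (take i D))}"

text \<open>Rows are listed from the top of the square (height \<open>n - 1\<close>) to the bottom.\<close>
definition area_partition :: "nat \<Rightarrow> step list \<Rightarrow> nat list" where
  "area_partition n D = map (\<lambda>r. card {c. (c, n - 1 - r) \<in> upper_left_boxes D}) [0..<n]"

definition area :: "nat \<Rightarrow> step list \<Rightarrow> nat" where
  "area n D = sum_list (area_partition n D)"


section \<open>Young modules and the parking space\<close>

definition young_block :: "nat list \<Rightarrow> nat \<Rightarrow> nat set" where
  "young_block lam i = {sum_list (take i lam) + 1..sum_list (take (Suc i) lam)}"

definition young_subgroup :: "nat \<Rightarrow> nat list \<Rightarrow> (nat \<Rightarrow> nat) set" where
  "young_subgroup n lam =
     {w \<in> carrier (sym_group n). \<forall>i < length lam. w ` young_block lam i = young_block lam i}"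

text \<open>\<open>M\<^sup>\<lambda>\<close> for a partition \<open>\<lambda>\<close> of \<open>n\<close>.\<close>
definition young_rep :: "nat \<Rightarrow> nat list \<Rightarrow> (nat \<Rightarrow> nat, (nat \<Rightarrow> nat) \<Rightarrow> complex) rep" where
  "young_rep n lam =
     ind_rep (sym_group n) (trivial_rep ((sym_group n)\<lparr>carrier := young_subgroup n lam\<rparr>))"

text \<open>Sequences \<open>(a\<^sub>1, \<dots>, a\<^sub>n)\<close> are functions on \<open>nat\<close> that vanish outside \<open>{1..n}\<close>.\<close>
definition parking_function :: "nat \<Rightarrow> (nat \<Rightarrow> nat) \<Rightarrow> bool" where
  "parking_function n a \<longleftrightarrow>
     (\<forall>i. i \<notin> {1..n} \<longrightarrow> a i = 0) \<and> (\<forall>i \<in> {1..n}. 1 \<le> a i) \<and>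
     (\<forall>i \<in> {1..n}. sort (map a [1..<n + 1]) ! (i - 1) \<le> i)"

definition permute_seq :: "(nat \<Rightarrow> nat) \<Rightarrow> (nat \<Rightarrow> nat) \<Rightarrow> (nat \<Rightarrow> nat)" where
  "permute_seq w a = (\<lambda>i. a (w i))"

text \<open>
  With functional composition as the product of permutations,
  \<open>(a\<^sub>1, \<dots>, a\<^sub>n) \<mapsto> (a\<^bsub>w 1\<^esub>, \<dots>, a\<^bsub>w n\<^esub>)\<close> is a right action; the left module structure is obtained
  from it, as usual, by letting \<open>w\<close> act through its inverse.
\<close>
definition park_rep :: "nat \<Rightarrow> (nat \<Rightarrow> nat, (nat \<Rightarrow> nat) \<Rightarrow>\<^sub>0 complex) rep" where
  "park_rep n =
     \<lparr>rgroup = sym_group n,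
      rspace = {f. \<forall>a \<in> Poly_Mapping.keys f. parking_function n a},
      ract = (\<lambda>w. push (permute_seq (inv\<^bsub>sym_group n\<^esub> w)))\<rparr>"

end

theory Submission
  imports Defs
begin

text \<open>
  Expand a polynomial of \<open>V\<^sub>n\<close> in monomials. The map sending \<open>f \<in> V\<^sub>n\<close> to its coefficients at the
  exponent vectors \<open>(a\<^sub>1 - 1, \<dots>, a\<^sub>n - 1, 0)\<close>, \<open>a\<close> a parking function, is visibly \<open>S\<^sub>n\<close>-equivariant and
  graded, and it turns out to be bijective. Hence \<open>V\<^sub>n\<close> is a permutation module whose orbits
  are indexed by sorted parking functions, that is, by Dyck paths.

  Bijectivity is proved for a more general family of graphs: the complete graph on \<open>S\<close> together with
  \<open>m j\<close> parallel edges from each \<open>j \<in> S\<close> to a sink, a sink edge at \<open>j\<close> contributing the factor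
  \<open>x\<^sub>j\<close>. Delete or contract a sink edge at \<open>i\<close>: the parking functions \<open>a\<close> with \<open>a\<^sub>i > 0\<close> are those of the
  deletion, shifted by one, and those with \<open>a\<^sub>i = 0\<close> are those of the contraction. On the polynomial
  side, these correspond to multiplication by \<open>x\<^sub>i\<close> and to setting \<open>x\<^sub>i = 0\<close>. Surjectivity follows
  directly. For injectivity, \<open>V\<^sub>n\<close> is enlarged to the space of polynomials killed by \<open>D\<^sub>I\<^sup>d\<close>, where
  \<open>D\<^sub>I = \<Sum>\<^sub>i\<^sub>\<in>\<^sub>I \<partial>\<^sub>i\<close> and \<open>d\<close> is the number of edges leaving \<open>I\<close>, for all \<open>I\<close>; this
  space is compatible with both operations. The graph \<open>K\<^sub>n\<^sub>+\<^sub>1\<close> is obtained by attaching the sink as a pendant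
  vertex at \<open>n + 1\<close>.
\<close>

section \<open>Coefficients and directional derivatives\<close>

abbreviation lookup :: "('a \<Rightarrow>\<^sub>0 'b::zero) \<Rightarrow> 'a \<Rightarrow> 'b" where
  "lookup \<equiv> Poly_Mapping.lookup"

abbreviation keys :: "('a \<Rightarrow>\<^sub>0 'b::zero) \<Rightarrow> 'a set" where
  "keys \<equiv> Poly_Mapping.keys"

definition unit_exp :: "nat \<Rightarrow> (nat \<Rightarrow>\<^sub>0 nat)" where
  "unit_exp i = Poly_Mapping.single i 1"

lemma lookup_unit_exp: "lookup (unit_exp i) j = (if i = j then 1 else 0)"
  by (simp add: unit_exp_def lookup_single when_def)

lemma var_conv_unit_exp: "var i = Poly_Mapping.single (unit_exp i) 1"
  by (simp add: var_def unit_exp_def)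

section \<open>Coefficients of multiples by constants and variables\<close>

lemma lookup_scaleC [simp]: "lookup (c *\<^sub>C f) m = c * lookup f m"
  for f :: "'a \<Rightarrow>\<^sub>0 complex"
  by (simp add: scaleC_poly_mapping.rep_eq scaleC_complex_def)

lemma lookup_single_mult:
  fixes g :: "'a::cancel_comm_monoid_add \<Rightarrow>\<^sub>0 'b::semiring_0"
  shows "lookup (Poly_Mapping.single a c * g) (m + a) = c * lookup g m"
  by (simp add: lookup_mult lookup_single when_mult add.commute[of m])

lemma scaleC_conv_mult: "c *\<^sub>C f = Poly_Mapping.single 0 c * f" for f :: cpoly
  by (rule poly_mapping_eqI) (use lookup_single_mult[of 0 c f] in simp)

lemma mult_scaleC_right: "f * (c *\<^sub>C g) = c *\<^sub>C (f * g)" for f g :: cpoly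
  by (simp add: scaleC_conv_mult mult_ac)

lemma scaleC_minus_one: "(- 1) *\<^sub>C f = - f" for f :: cpoly
  by (rule poly_mapping_eqI) simp

lemma lookup_var_mult_add: "lookup (var i * g) (m + unit_exp i) = lookup g m"
  unfolding var_conv_unit_exp by (simp add: lookup_single_mult)

lemma lookup_var_mult_0: "lookup (var i * g) m = 0" if "lookup m i = 0"
proof -
  have "m \<noteq> unit_exp i + q" for q
    using that by (metis add_eq_0_iff_both_eq_0 lookup_add lookup_unit_exp one_neq_zero)
  then show ?thesis
    by (simp add: var_conv_unit_exp lookup_mult lookup_single when_mult)
qed

text \<open>Either x_i does not divide the monomial or it can be split off. For parking exponents
  these two cases become contraction and deletion.\<close>

lemma monomial_cases [case_names zero add]:
  fixes m :: "nat \<Rightarrow>\<^sub>0 nat"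
  obtains "lookup m i = 0" | m' where "m = m' + unit_exp i"
proof (cases "lookup m i = 0")
  case False
  then have "m = (m - unit_exp i) + unit_exp i"
    by (intro poly_mapping_eqI) (auto simp: lookup_add lookup_minus lookup_unit_exp)
  then show ?thesis using that by blast
qed (use that in blast)

lemma var_neq_0: "var i \<noteq> 0"
  by (metis lookup_single_eq lookup_zero one_neq_zero var_def)

text \<open>Serves two purposes: with the condition \<open>lookup m i = 0\<close> it substitutes 0
  for x_i, with a condition on the degree it projects to a homogeneous component.\<close>

lift_definition restrict_poly :: "('a \<Rightarrow> bool) \<Rightarrow> ('a \<Rightarrow>\<^sub>0 'b::zero) \<Rightarrow> ('a \<Rightarrow>\<^sub>0 'b)"
  is "\<lambda>P f m. if P m then f m else 0"
  by (erule finite_subset[rotated]) auto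

lemma lookup_restrict_poly [simp]: "lookup (restrict_poly P f) m = (if P m then lookup f m else 0)"
  by transfer simp

lift_definition divide_var :: "nat \<Rightarrow> cpoly \<Rightarrow> cpoly"
  is "\<lambda>i f m. f (m + unit_exp i)"
proof -
  fix i and f :: "(nat \<Rightarrow>\<^sub>0 nat) \<Rightarrow> complex"
  assume "finite {x. f x \<noteq> 0}"
  then have "finite ((\<lambda>m. m + unit_exp i) -` {x. f x \<noteq> 0})"
    by (rule finite_vimageI) (simp add: inj_def)
  then show "finite {x. f (x + unit_exp i) \<noteq> 0}"
    by (simp add: vimage_def)
qed

lemma lookup_divide_var [simp]: "lookup (divide_var i f) m = lookup f (m + unit_exp i)"
  by transfer simp

text \<open>The summands are the value at x_i = 0 and the part divisible by x_i; contraction takes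
  care of the first, deletion of the second.\<close>

lemma restrict_plus_divide_var:
  "f = restrict_poly (\<lambda>m. lookup m i = 0) f + var i * divide_var i f"
proof (rule poly_mapping_eqI)
  fix m :: "nat \<Rightarrow>\<^sub>0 nat"
  show "lookup f m = lookup (restrict_poly (\<lambda>m. lookup m i = 0) f + var i * divide_var i f) m"
    by (cases m rule: monomial_cases[of _ i])
      (auto simp: lookup_add lookup_var_mult_0 lookup_var_mult_add lookup_unit_exp)
qed

section \<open>Partial and directional derivatives\<close>

lift_definition partial_deriv :: "nat \<Rightarrow> cpoly \<Rightarrow> cpoly"
  is "\<lambda>i f m. (of_nat (Poly_Mapping.lookup m i) + 1) * f (m + unit_exp i)"
proof -
  fix i and f :: "(nat \<Rightarrow>\<^sub>0 nat) \<Rightarrow> complex"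
  assume "finite {x. f x \<noteq> 0}"
  then have "finite ((\<lambda>m. m + unit_exp i) -` {x. f x \<noteq> 0})"
    by (rule finite_vimageI) (simp add: inj_def)
  then show "finite {m. (of_nat (Poly_Mapping.lookup m i) + 1) * f (m + unit_exp i) \<noteq> 0}"
    by (rule finite_subset[rotated]) auto
qed

lemma lookup_partial_deriv [simp]:
  "lookup (partial_deriv i f) m = (of_nat (lookup m i) + 1) * lookup f (m + unit_exp i)"
  by transfer simp

lemma partial_deriv_var_mult:
  "partial_deriv j (var i * g) = var i * partial_deriv j g + (if i = j then g else 0)"
proof (rule poly_mapping_eqI)
  fix m :: "nat \<Rightarrow>\<^sub>0 nat"
  show "lookup (partial_deriv j (var i * g)) m =
      lookup (var i * partial_deriv j g + (if i = j then g else 0)) m"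
  proof (cases m rule: monomial_cases[of _ i])
    case zero
    then show ?thesis
      by (auto simp: lookup_add lookup_var_mult_0 lookup_var_mult_add lookup_unit_exp)
  next
    case (add m')
    have "lookup (var i * g) (m' + unit_exp i + unit_exp j) = lookup g (m' + unit_exp j)"
      by (metis add.assoc add.commute lookup_var_mult_add)
    then show ?thesis
      by (auto simp: add lookup_add lookup_var_mult_add lookup_unit_exp algebra_simps)
  qed
qed

definition dir_deriv :: "nat set \<Rightarrow> cpoly \<Rightarrow> cpoly" where
  "dir_deriv I f = (\<Sum>j\<in>I. partial_deriv j f)"

lemma lookup_dir_deriv:
  "lookup (dir_deriv I f) m = (\<Sum>j\<in>I. (of_nat (lookup m j) + 1) * lookup f (m + unit_exp j))"
  by (simp add: dir_deriv_def lookup_sum)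

lemma dir_deriv_add: "dir_deriv I (f + g) = dir_deriv I f + dir_deriv I g"
  by (rule poly_mapping_eqI) (simp add: lookup_dir_deriv lookup_add algebra_simps sum.distrib)

lemma dir_deriv_scaleC: "dir_deriv I (c *\<^sub>C f) = c *\<^sub>C dir_deriv I f"
  by (rule poly_mapping_eqI) (simp add: lookup_dir_deriv algebra_simps sum_distrib_left)

lemma dir_deriv_0 [simp]: "dir_deriv I 0 = 0"
  by (rule poly_mapping_eqI) (simp add: lookup_dir_deriv)

lemma dir_deriv_var_mult:
  assumes "finite I"
  shows "dir_deriv I (var i * g) = var i * dir_deriv I g + (if i \<in> I then g else 0)"
  using assms by (simp add: dir_deriv_def partial_deriv_var_mult sum.distrib sum_distrib_left)

lemma dir_deriv_pow_0 [simp]: "(dir_deriv I ^^ d) 0 = 0"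
  by (induction d) auto

lemma dir_deriv_pow_add: "(dir_deriv I ^^ d) (f + g) = (dir_deriv I ^^ d) f + (dir_deriv I ^^ d) g"
  by (induction d) (auto simp: dir_deriv_add)

lemma dir_deriv_pow_scaleC: "(dir_deriv I ^^ d) (c *\<^sub>C f) = c *\<^sub>C (dir_deriv I ^^ d) f"
  by (induction d) (auto simp: dir_deriv_scaleC)

text \<open>Leibniz rule for a linear factor: D_I x_i is a constant, so at most one of the d
  derivatives can hit it. At d = 0 the truncated exponent d - 1 does no harm, because the
  coefficient is 0.\<close>

lemma dir_deriv_pow_var_mult:
  assumes "finite I"
  shows "(dir_deriv I ^^ d) (var i * g) =
    var i * (dir_deriv I ^^ d) g + (if i \<in> I then of_nat d *\<^sub>C (dir_deriv I ^^ (d - 1)) g else 0)"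
proof (induction d)
  case (Suc d)
  show ?case
  proof (cases "i \<in> I")
    case True
    have "of_nat d *\<^sub>C dir_deriv I ((dir_deriv I ^^ (d - 1)) g) = of_nat d *\<^sub>C (dir_deriv I ^^ d) g"
      by (cases d) auto
    then show ?thesis
      using True by (simp add: Suc dir_deriv_add dir_deriv_var_mult[OF assms] dir_deriv_scaleC
          scaleC_add_left scaleC_one add_ac)
  qed (simp add: Suc dir_deriv_var_mult[OF assms])
qed simp

lemma dir_deriv_pow_mono: "(dir_deriv I ^^ d) f = 0 \<Longrightarrow> d \<le> d' \<Longrightarrow> (dir_deriv I ^^ d') f = 0"
  using funpow_add[of "d' - d" d "dir_deriv I"] by simp

text \<open>The operator \<open>x\<^sub>i D\<^sub>I\<close> has only non-negative eigenvalues: in coordinates where \<open>D\<^sub>I\<close> is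
  differentiation with respect to \<open>t = x\<^sub>i\<close>, it is \<open>t d/dt\<close>.\<close>
lemma var_dir_deriv_plus_scale_eq_0:
  assumes "finite I" "i \<in> I" "d > 0" and eq: "var i * dir_deriv I u + of_nat d *\<^sub>C u = 0"
  shows "u = 0"
proof -
  have "lookup u m = 0" if "lookup m i = k" for k m
    using that
  proof (induction k arbitrary: m)
    case 0
    have "lookup (var i * dir_deriv I u + of_nat d *\<^sub>C u) m = 0"
      by (simp add: eq)
    then show ?case
      using 0 \<open>d > 0\<close> by (simp add: lookup_add lookup_var_mult_0)
  next
    case (Suc k)
    then obtain m' where m': "m = m' + unit_exp i"
      by (cases m rule: monomial_cases[of _ i]) auto
    have k: "lookup m' i = k"
      using Suc.prems by (simp add: m' lookup_add lookup_unit_exp)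
    \<comment> \<open>Raising another variable leaves the exponent of x_i at k, so the induction
      hypothesis removes all terms of D_I u at m' except the one for j = i.\<close>
    have "lookup u (m' + unit_exp j) = 0" if "j \<noteq> i" for j
      using that by (intro Suc.IH) (simp add: lookup_add lookup_unit_exp k)
    then have "lookup (dir_deriv I u) m' = (\<Sum>j\<in>I. if j = i then (of_nat k + 1) * lookup u m else 0)"
      unfolding lookup_dir_deriv by (intro sum.cong) (auto simp: m' k)
    then have "lookup (dir_deriv I u) m' = (of_nat k + 1) * lookup u m"
      using assms by simp
    then have "(of_nat k + 1) * lookup u m + of_nat d * lookup u m = 0"
      using arg_cong[OF eq, of "\<lambda>p. lookup p m"] by (simp add: lookup_add m' lookup_var_mult_add)
    then have "of_nat (k + 1 + d) * lookup u m = 0"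
      by (simp add: algebra_simps)
    then show ?case
      by (simp only: mult_eq_0_iff of_nat_eq_0_iff) simp
  qed
  then show ?thesis
    by (intro poly_mapping_eqI) simp
qed

section \<open>Deletion and contraction\<close>

text \<open>
  Throughout, \<open>S\<close> and \<open>m\<close> describe the complete graph on \<open>S\<close> with \<open>m j\<close> edges from \<open>j\<close> to the sink.
  A subgraph is given by the number \<open>b j\<close> of its sink edges at \<open>j\<close> and its set \<open>H\<close> of edges within \<open>S\<close>;
  connectedness of the complement is expressed by cuts.
\<close>

definition cut_size :: "nat set \<Rightarrow> (nat \<Rightarrow> nat) \<Rightarrow> nat set \<Rightarrow> nat" where
  "cut_size S m I = sum m I + card I * card (S - I)"

text \<open>The G-parking functions of the graph: \<open>m i + card (S - I)\<close> counts the edges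
  at i that leave I.\<close>

definition sink_parking :: "nat set \<Rightarrow> (nat \<Rightarrow> nat) \<Rightarrow> (nat \<Rightarrow>\<^sub>0 nat) set" where
  "sink_parking S m =
     {a. keys a \<subseteq> S \<and> (\<forall>I\<subseteq>S. I \<noteq> {} \<longrightarrow> (\<exists>i\<in>I. lookup a i < m i + card (S - I)))}"

text \<open>The Macaulay inverse system of a power ideal. Unlike the span of slim products it is
  given by equations, and these pass to the value at x_i = 0 and to the quotient by x_i.\<close>

definition cut_power_space :: "nat set \<Rightarrow> (nat \<Rightarrow> nat) \<Rightarrow> cpoly set" where
  "cut_power_space S m =
     {f. (\<forall>a\<in>keys f. keys a \<subseteq> S) \<and>
         (\<forall>I\<subseteq>S. I \<noteq> {} \<longrightarrow> (dir_deriv I ^^ cut_size S m I) f = 0)}"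

definition sink_slim :: "nat set \<Rightarrow> (nat \<Rightarrow> nat) \<Rightarrow> (nat \<Rightarrow> nat) \<Rightarrow> nat set set \<Rightarrow> bool" where
  "sink_slim S m b H \<longleftrightarrow>
     (\<forall>i\<in>S. b i \<le> m i) \<and> H \<subseteq> {e. e \<subseteq> S \<and> card e = 2} \<and>
     (\<forall>I\<subseteq>S. I \<noteq> {} \<longrightarrow> (\<exists>i\<in>I. b i < m i) \<or> (\<exists>i\<in>I. \<exists>j\<in>S - I. {i, j} \<notin> H))"

definition sink_poly :: "nat set \<Rightarrow> (nat \<Rightarrow> nat) \<Rightarrow> nat set set \<Rightarrow> cpoly" where
  "sink_poly S b H = (\<Prod>i\<in>S. var i ^ b i) * graph_poly H"

definition sink_slim_space :: "nat set \<Rightarrow> (nat \<Rightarrow> nat) \<Rightarrow> cpoly set" where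
  "sink_slim_space S m = cvec.span {sink_poly S b H | b H. sink_slim S m b H}"

text \<open>The induction hypotheses of \<open>step\<close> are deletion and contraction of a sink
  edge at i. Under contraction i merges with the sink, so its edge to j becomes a further sink edge
  at j. Deletion lowers the total of m on the same S, contraction shrinks S.\<close>

lemma deletion_contraction_induct [consumes 1, case_names empty isolated step]:
  fixes m :: "'a \<Rightarrow> nat"
  assumes "finite S"
    and empty: "\<And>m. P {} m"
    and isolated: "\<And>S m. finite S \<Longrightarrow> S \<noteq> {} \<Longrightarrow> \<forall>i\<in>S. m i = 0 \<Longrightarrow> P S m"
    and step: "\<And>S (m :: 'a \<Rightarrow> nat) i. finite S \<Longrightarrow> i \<in> S \<Longrightarrow> m i > 0 \<Longrightarrow>
      P S (m(i := m i - 1)) \<Longrightarrow> P (S - {i}) (\<lambda>j. m j + 1) \<Longrightarrow> P S m"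
  shows "P S m"
  using assms(1)
proof (induction S arbitrary: m rule: finite_psubset_induct)
  case (psubset S)
  show ?case
  proof (induction "sum m S" arbitrary: m)
    case 0
    then show ?case
      using psubset.hyps empty isolated by (cases "S = {}") auto
  next
    case (Suc k)
    then obtain i where i: "i \<in> S" "m i > 0"
      by (metis Zero_not_Suc gr0I sum.neutral)
    have "sum (m(i := m i - 1)) S = (m i - 1) + sum m (S - {i})"
      using psubset.hyps i by (simp add: sum.remove[of S i])
    then have "k = sum (m(i := m i - 1)) S"
      using Suc.hyps(2) i psubset.hyps by (simp add: sum.remove[of S i])
    then have "P S (m(i := m i - 1))"
      by (rule Suc.hyps(1))
    moreover have "P (S - {i}) (\<lambda>j. m j + 1)"
      by (rule psubset.IH) (use i in auto)
    ultimately show ?case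
      using step psubset.hyps i by blast
  qed
qed

text \<open>For I avoiding i, each j in I keeps its number of edges leaving I, as the edge from j to
  i has only become a sink edge. Sets I containing i impose nothing, because the exponent 0 at i is
  below \<open>m i\<close>.\<close>

lemma sink_parking_contract:
  assumes "finite S" "i \<in> S" "m i > 0" "lookup a i = 0"
  shows "a \<in> sink_parking (S - {i}) (\<lambda>j. m j + 1) \<longleftrightarrow> a \<in> sink_parking S m"
proof -
  have keys: "keys a \<subseteq> S - {i} \<longleftrightarrow> keys a \<subseteq> S"
    using assms by (auto simp: in_keys_iff)
  have out: "m j + 1 + card (S - {i} - I) = m j + card (S - I)" if "I \<subseteq> S - {i}" for I j
  proof -
    have "S - I = insert i (S - {i} - I)"
      using that assms by auto
    then show ?thesis
      using assms by simp
  qed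
  show ?thesis
  proof
    assume *: "a \<in> sink_parking (S - {i}) (\<lambda>j. m j + 1)"
    have "\<exists>j\<in>I. lookup a j < m j + card (S - I)" if "I \<subseteq> S" "I \<noteq> {}" for I
    proof (cases "i \<in> I")
      case True
      then show ?thesis
        using assms(3,4) by (intro bexI[of _ i]) auto
    next
      case False
      then have "I \<subseteq> S - {i}"
        using that by auto
      then have "\<exists>j\<in>I. lookup a j < m j + 1 + card (S - {i} - I)"
        using * that unfolding sink_parking_def by blast
      then show ?thesis
        unfolding out[OF \<open>I \<subseteq> S - {i}\<close>] .
    qed
    then show "a \<in> sink_parking S m"
      using * keys by (auto simp: sink_parking_def)
  next
    assume *: "a \<in> sink_parking S m"
    have "\<exists>j\<in>I. lookup a j < m j + 1 + card (S - {i} - I)" if "I \<subseteq> S - {i}" "I \<noteq> {}" for I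
      using * that unfolding out[OF that(1)] sink_parking_def by blast
    then show "a \<in> sink_parking (S - {i}) (\<lambda>j. m j + 1)"
      using * keys by (auto simp: sink_parking_def)
  qed
qed

lemma sink_parking_delete:
  assumes "i \<in> S" "m i > 0"
  shows "a + unit_exp i \<in> sink_parking S m \<longleftrightarrow> a \<in> sink_parking S (m(i := m i - 1))"
proof -
  have "keys (a + unit_exp i) = insert i (keys a)"
    by (auto simp: in_keys_iff lookup_add lookup_unit_exp split: if_splits)
  moreover have "lookup (a + unit_exp i) j < m j + c \<longleftrightarrow> lookup a j < (m(i := m i - 1)) j + c" for j c
    using assms by (auto simp: lookup_add lookup_unit_exp)
  ultimately show ?thesis
    using assms by (auto simp: sink_parking_def)
qed

section \<open>The cut power space under contraction and deletion\<close>

lemma dir_deriv_pow_restrict: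
  assumes "i \<notin> I"
  shows "(dir_deriv I ^^ d) (restrict_poly (\<lambda>m. lookup m i = 0) f) =
    restrict_poly (\<lambda>m. lookup m i = 0) ((dir_deriv I ^^ d) f)"
proof (induction d)
  case (Suc d)
  have "dir_deriv I (restrict_poly (\<lambda>m. lookup m i = 0) g) =
      restrict_poly (\<lambda>m. lookup m i = 0) (dir_deriv I g)" for g
    by (rule poly_mapping_eqI)
      (use assms in \<open>auto simp: lookup_dir_deriv lookup_add lookup_unit_exp intro!: sum.cong\<close>)
  then show ?case
    by (simp add: Suc)
qed simp

text \<open>For I avoiding i the derivative D_I commutes with setting x_i = 0, and contraction does
  not change the number of edges leaving I.\<close>

lemma cut_power_space_contract:
  assumes "finite S" "i \<in> S" "f \<in> cut_power_space S m"
  shows "restrict_poly (\<lambda>a. lookup a i = 0) f \<in> cut_power_space (S - {i}) (\<lambda>j. m j + 1)"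
proof -
  have "(dir_deriv I ^^ cut_size (S - {i}) (\<lambda>j. m j + 1) I) (restrict_poly (\<lambda>a. lookup a i = 0) f) = 0"
    if I: "I \<subseteq> S - {i}" "I \<noteq> {}" for I
  proof -
    have "S - I = insert i (S - {i} - I)"
      using I assms by auto
    then have "cut_size (S - {i}) (\<lambda>j. m j + 1) I = cut_size S m I"
      using assms sum.distrib[of m "\<lambda>_. 1" I] by (simp add: cut_size_def algebra_simps)
    moreover have "(dir_deriv I ^^ cut_size S m I) f = 0"
      using assms(3) I unfolding cut_power_space_def by blast
    moreover have "i \<notin> I" using I by auto
    ultimately show ?thesis
      by (simp add: dir_deriv_pow_restrict poly_mapping_eq_iff fun_eq_iff)
  qed
  moreover have "keys a \<subseteq> S - {i}" if "a \<in> keys (restrict_poly (\<lambda>a. lookup a i = 0) f)" for a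
  proof -
    have "a \<in> keys f" "i \<notin> keys a"
      using that by (simp_all add: in_keys_iff split: if_splits)
    then show ?thesis
      using assms(3) unfolding cut_power_space_def by blast
  qed
  ultimately show ?thesis
    unfolding cut_power_space_def by blast
qed

text \<open>If i lies in I, the cut loses an edge. With d the new cut size and u = D_I^d g, the
  Leibniz rule turns D_I^(d+1) (x_i g) = 0 into x_i D_I u + (d + 1) u = 0, and
  \<open>var_dir_deriv_plus_scale_eq_0\<close> gives u = 0. If i is outside I, x_i is a constant for
  D_I and cancels.\<close>

lemma cut_power_space_delete:
  assumes "finite S" "i \<in> S" "m i > 0" and f: "var i * g \<in> cut_power_space S m"
  shows "g \<in> cut_power_space S (m(i := m i - 1))"
proof -
  have "(dir_deriv I ^^ cut_size S (m(i := m i - 1)) I) g = 0" if I: "I \<subseteq> S" "I \<noteq> {}" for I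
  proof -
    have fin: "finite I" using I assms finite_subset by blast
    have 0: "(dir_deriv I ^^ cut_size S m I) (var i * g) = 0"
      using f I unfolding cut_power_space_def by blast
    show ?thesis
    proof (cases "i \<in> I")
      case True
      then have d: "cut_size S m I = Suc (cut_size S (m(i := m i - 1)) I)"
        using fin assms by (simp add: cut_size_def sum.remove[of I i])
      show ?thesis
        by (rule var_dir_deriv_plus_scale_eq_0[OF fin True zero_less_Suc[of "cut_size S (m(i := m i - 1)) I"]])
          (use 0[unfolded d dir_deriv_pow_var_mult[OF fin]] True in \<open>simp del: of_nat_Suc\<close>)
    next
      case False
      then have "cut_size S (m(i := m i - 1)) I = cut_size S m I"
        by (auto simp: cut_size_def intro!: sum.cong)
      then show ?thesis
        using 0 False by (simp add: dir_deriv_pow_var_mult[OF fin] var_neq_0)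
    qed
  qed
  moreover have "keys a \<subseteq> S" if "a \<in> keys g" for a
  proof -
    have "a + unit_exp i \<in> keys (var i * g)"
      using that by (simp add: in_keys_iff lookup_var_mult_add)
    then have "keys (a + unit_exp i) \<subseteq> S"
      using f by (auto simp: cut_power_space_def)
    moreover have "keys a \<subseteq> keys (a + unit_exp i)"
      by (auto simp: in_keys_iff lookup_add)
    ultimately show ?thesis by auto
  qed
  ultimately show ?thesis
    unfolding cut_power_space_def by blast
qed

text \<open>Injectivity of the coefficient map. Contraction shows that f vanishes at x_i = 0, so f
  is x_i times its quotient, and deletion shows that the quotient vanishes.\<close>

lemma cut_power_space_eq_0:
  assumes "finite S" "f \<in> cut_power_space S m" "\<forall>a\<in>sink_parking S m. lookup f a = 0"
  shows "f = 0"
  using assms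
proof (induction S m arbitrary: f rule: deletion_contraction_induct)
  case (empty m)
  then have "lookup f 0 = 0"
    by (simp add: sink_parking_def)
  moreover have "a = 0" if "a \<in> keys f" for a
    using that empty by (auto simp: cut_power_space_def)
  ultimately show ?case
    by (metis in_keys_iff lookup_zero poly_mapping_eqI)
next
  case (isolated S m)
  \<comment> \<open>Without sink edges no edge leaves S, so the exponent is 0 and the equation says
    f = 0.\<close>
  then have "(dir_deriv S ^^ cut_size S m S) f = 0"
    by (simp add: cut_power_space_def)
  then show ?case
    using isolated by (simp add: cut_size_def)
next
  case (step S m i)
  have "restrict_poly (\<lambda>a. lookup a i = 0) f = 0"
  proof (rule step.IH(2))
    show "restrict_poly (\<lambda>a. lookup a i = 0) f \<in> cut_power_space (S - {i}) (\<lambda>j. m j + 1)"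
      by (intro cut_power_space_contract step)
    show "\<forall>a\<in>sink_parking (S - {i}) (\<lambda>j. m j + 1). lookup (restrict_poly (\<lambda>a. lookup a i = 0) f) a = 0"
      using step sink_parking_contract[of S i m] by auto
  qed
  then have f: "f = var i * divide_var i f"
    using restrict_plus_divide_var[of f i] by simp
  have "divide_var i f = 0"
  proof (rule step.IH(1))
    show "divide_var i f \<in> cut_power_space S (m(i := m i - 1))"
      by (rule cut_power_space_delete) (use step f in auto)
    show "\<forall>a\<in>sink_parking S (m(i := m i - 1)). lookup (divide_var i f) a = 0"
      using step sink_parking_delete[of i S m] by auto
  qed
  then show ?case
    using f by simp
qed

section \<open>Surjectivity: lifting and multiplying slim products\<close>

lemma edge_poly_sym: "edge_poly {i, j} = var i - var j \<or> edge_poly {i, j} = var j - var i"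
  by (cases "i \<le> j") (simp_all add: edge_poly_def)

text \<open>Modulo x_i the polynomial of the edge {i, j} is x_j up to sign; s collects the
  signs.\<close>

lemma prod_edge_poly_cong_var:
  assumes "finite T"
  shows "\<exists>s. (s = 1 \<or> s = - 1) \<and>
    var i dvd s * (\<Prod>j\<in>T. edge_poly {i, j}) - (\<Prod>j\<in>T. var j)"
  using assms
proof (induction T)
  case (insert k T)
  then obtain s q where s: "s = 1 \<or> s = - 1"
    and q: "s * (\<Prod>j\<in>T. edge_poly {i, j}) - (\<Prod>j\<in>T. var j) = var i * q"
    by (auto simp: dvd_def)
  define E where "E = (\<Prod>j\<in>T. edge_poly {i, j})"
  have V: "(\<Prod>j\<in>T. var j) = s * E - var i * q"
    using q by (simp add: E_def algebra_simps)
  from edge_poly_sym[of i k] show ?case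
  proof
    assume e: "edge_poly {i, k} = var i - var k"
    have "- s * (edge_poly {i, k} * E) - var k * (s * E - var i * q) = var i * (var k * q - s * E)"
      by (simp add: e algebra_simps)
    then show ?thesis
      using insert.hyps s V by (intro exI[of _ "- s"]) (auto simp: E_def)
  next
    assume e: "edge_poly {i, k} = var k - var i"
    have "s * (edge_poly {i, k} * E) - var k * (s * E - var i * q) = var i * (var k * q - s * E)"
      by (simp add: e algebra_simps)
    then show ?thesis
      using insert.hyps s V by (intro exI[of _ s]) (auto simp: E_def)
  qed
qed (auto intro!: exI[of _ 1])

text \<open>In the contracted graph the sink edges at j comprise the \<open>m j\<close> old ones and
  the former edge {i, j}. Where a generator uses them all, the edge {i, j} is put back into the
  subgraph; its factor, x_i - x_j up to sign, replaces one x_j modulo x_i.\<close>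

lemma sink_poly_lift:
  assumes fin: "finite S" and i: "i \<in> S" "m i > 0"
    and slim: "sink_slim (S - {i}) (\<lambda>j. m j + 1) b H"
  shows "\<exists>f\<in>sink_slim_space S m. var i dvd f - sink_poly (S - {i}) b H"
proof -
  define T where "T = {j \<in> S - {i}. b j = m j + 1}"
  \<comment> \<open>No sink edge at i is used, and \<open>m i > 0\<close>, so every I containing i
    has a free edge to the sink.\<close>
  define b' where "b' = (\<lambda>j. if j = i then 0 else min (b j) (m j))"
  define H' where "H' = H \<union> (\<lambda>j. {i, j}) ` T"
  have b: "b j \<le> m j + 1" if "j \<in> S - {i}" for j
    using slim that by (auto simp: sink_slim_def)
  have H: "H \<subseteq> {e. e \<subseteq> S - {i} \<and> card e = 2}"
    using slim by (simp add: sink_slim_def)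
  have fT: "finite T" and fH: "finite H"
    using fin finite_subset[OF H] by (auto simp: T_def)
  have "sink_slim S m b' H'"
    unfolding sink_slim_def
  proof (intro conjI allI impI)
    show "\<forall>j\<in>S. b' j \<le> m j"
      by (simp add: b'_def)
    show "H' \<subseteq> {e. e \<subseteq> S \<and> card e = 2}"
      using H i by (auto simp: H'_def T_def)
  next
    fix I assume I: "I \<subseteq> S" "I \<noteq> {}"
    show "(\<exists>j\<in>I. b' j < m j) \<or> (\<exists>j\<in>I. \<exists>k\<in>S - I. {j, k} \<notin> H')"
    proof (cases "i \<in> I")
      case True
      then show ?thesis using i by (auto simp: b'_def)
    next
      case False
      then have "I \<subseteq> S - {i}" using I by auto
      then consider j where "j \<in> I" "b j < m j + 1" | j k where "j \<in> I" "k \<in> S - {i} - I" "{j, k} \<notin> H"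
        using slim I unfolding sink_slim_def by meson
      then show ?thesis
      proof cases
        case 1
        \<comment> \<open>Here j is outside \<open>T\<close>, so the edge {j, i} is free and leaves
          I.\<close>
        then have "{j, i} \<notin> H'"
          using H False by (auto simp: H'_def T_def doubleton_eq_iff)
        then show ?thesis using 1 i False by blast
      next
        case 2
        then have "{j, k} \<notin> H'"
          using False by (auto simp: H'_def doubleton_eq_iff)
        then show ?thesis using 2 by blast
      qed
    qed
  qed
  then have in_span: "sink_poly S b' H' \<in> sink_slim_space S m"
    unfolding sink_slim_space_def by (intro cvec.span_base) auto
  obtain s q where s: "s = 1 \<or> s = - 1"
    and q: "s * (\<Prod>j\<in>T. edge_poly {i, j}) - (\<Prod>j\<in>T. var j) = var i * q"
    using prod_edge_poly_cong_var[OF fT] unfolding dvd_def by blast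
  define C where "C = (\<Prod>j\<in>S - {i}. var j ^ b' j) * graph_poly H"
  have "graph_poly H' = graph_poly H * (\<Prod>e\<in>(\<lambda>j. {i, j}) ` T. edge_poly e)"
    unfolding graph_poly_def H'_def using H fT fH by (intro prod.union_disjoint) auto
  also have "(\<Prod>e\<in>(\<lambda>j. {i, j}) ` T. edge_poly e) = (\<Prod>j\<in>T. edge_poly {i, j})"
    by (subst prod.reindex) (auto simp: inj_on_def doubleton_eq_iff)
  finally have new: "sink_poly S b' H' = C * (\<Prod>j\<in>T. edge_poly {i, j})"
    using fin i by (simp add: sink_poly_def C_def prod.remove[of S i] b'_def mult_ac)
  \<comment> \<open>Truncating \<open>b j\<close> at \<open>m j\<close> loses exactly one factor
    x_j, and only for j in \<open>T\<close>.\<close>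
  have "(\<Prod>j\<in>S - {i}. var j ^ b j) = (\<Prod>j\<in>S - {i}. var j ^ b' j * (if b j = m j + 1 then var j else 1))"
    by (rule prod.cong) (use b in \<open>auto simp: b'_def min_def dest!: b intro: antisym simp flip: power_Suc2\<close>)
  also have "\<dots> = (\<Prod>j\<in>S - {i}. var j ^ b' j) * (\<Prod>j\<in>T. var j)"
    unfolding prod.distrib T_def using fin by (simp only: prod.inter_filter finite_Diff)
  finally have old: "sink_poly (S - {i}) b H = C * (\<Prod>j\<in>T. var j)"
    by (simp add: sink_poly_def C_def mult_ac)
  have "s * sink_poly S b' H' - sink_poly (S - {i}) b H =
      C * (s * (\<Prod>j\<in>T. edge_poly {i, j}) - (\<Prod>j\<in>T. var j))"
    by (simp add: new old algebra_simps)
  then have "var i dvd s * sink_poly S b' H' - sink_poly (S - {i}) b H"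
    unfolding q by simp
  moreover have "s * sink_poly S b' H' \<in> sink_slim_space S m"
    using s in_span by (auto simp: sink_slim_space_def cvec.span_neg)
  ultimately show ?thesis by blast
qed

lemma sink_slim_space_lift:
  assumes "finite S" "i \<in> S" "m i > 0" "g \<in> sink_slim_space (S - {i}) (\<lambda>j. m j + 1)"
  shows "\<exists>f\<in>sink_slim_space S m. var i dvd f - g"
  using assms(4) unfolding sink_slim_space_def[of "S - {i}"]
proof (induction rule: cvec.span_induct_alt)
  case base
  then show ?case
    by (intro bexI[of _ 0]) (auto simp: sink_slim_space_def cvec.span_zero)
next
  case (step c x y)
  then obtain f1 where f1: "f1 \<in> sink_slim_space S m" "var i dvd f1 - x"
    using sink_poly_lift[of S i m, OF assms(1-3)] by blast
  obtain f2 where f2: "f2 \<in> sink_slim_space S m" "var i dvd f2 - y"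
    using step by blast
  have eq: "c *\<^sub>C f1 + f2 - (c *\<^sub>C x + y) = Poly_Mapping.single 0 c * (f1 - x) + (f2 - y)"
    by (simp add: scaleC_conv_mult algebra_simps)
  have "var i dvd c *\<^sub>C f1 + f2 - (c *\<^sub>C x + y)"
    unfolding eq using f1 f2 by (intro dvd_add dvd_mult)
  moreover have "c *\<^sub>C f1 + f2 \<in> sink_slim_space S m"
    using f1 f2 by (simp add: sink_slim_space_def cvec.span_add cvec.span_scale)
  ultimately show ?case by blast
qed

text \<open>Adding a sink edge at i to graph and subgraph at once leaves the complement, and hence
  its connectedness, unchanged.\<close>

lemma sink_slim_space_var_mult:
  assumes fin: "finite S" and i: "i \<in> S" "m i > 0" and g: "g \<in> sink_slim_space S (m(i := m i - 1))"
  shows "var i * g \<in> sink_slim_space S m"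
  using g unfolding sink_slim_space_def[of _ "m(i := m i - 1)"]
proof (induction rule: cvec.span_induct_alt)
  case base
  then show ?case by (simp add: sink_slim_space_def cvec.span_zero)
next
  case (step c x y)
  then obtain b H where x: "x = sink_poly S b H" and slim: "sink_slim S (m(i := m i - 1)) b H"
    by blast
  have "var i * x = sink_poly S (b(i := Suc (b i))) H"
    using fin i by (simp add: x sink_poly_def prod.remove[of S i] mult_ac)
  moreover have "sink_slim S m (b(i := Suc (b i))) H"
    unfolding sink_slim_def
  proof (intro conjI allI impI)
    have "b j \<le> (m(i := m i - 1)) j" if "j \<in> S" for j
      using slim that unfolding sink_slim_def by blast
    then have "(b(i := Suc (b i))) j \<le> m j" if "j \<in> S" for j
      using that i by (cases "j = i") fastforce+
    then show "\<forall>j\<in>S. (b(i := Suc (b i))) j \<le> m j"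
      by blast
    show "H \<subseteq> {e. e \<subseteq> S \<and> card e = 2}"
      using slim by (simp add: sink_slim_def)
  next
    fix I assume I: "I \<subseteq> S" "I \<noteq> {}"
    have "(b(i := Suc (b i))) j < m j" if "b j < (m(i := m i - 1)) j" for j
      using that i by (auto split: if_splits)
    then show "(\<exists>j\<in>I. (b(i := Suc (b i))) j < m j) \<or> (\<exists>j\<in>I. \<exists>k\<in>S - I. {j, k} \<notin> H)"
      using slim I unfolding sink_slim_def by meson
  qed
  ultimately have "var i * x \<in> sink_slim_space S m"
    unfolding sink_slim_space_def by (intro cvec.span_base) auto
  then show ?case
    using step by (simp add: sink_slim_space_def distrib_left mult_scaleC_right
        cvec.span_add cvec.span_scale)
qed

text \<open>Surjectivity of the coefficient map. Contraction yields the prescribed coefficients at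
  exponents without x_i; lifting changes g only by multiples of x_i, so these values survive.
  Deletion then corrects the other exponents by a multiple of x_i.\<close>

lemma sink_slim_space_interpolate:
  assumes "finite S"
  shows "\<exists>f\<in>sink_slim_space S m. \<forall>a\<in>sink_parking S m. lookup f a = c a"
  using assms
proof (induction S m arbitrary: c rule: deletion_contraction_induct)
  case (empty m)
  have "sink_poly {} (\<lambda>_. 0) {} = 1"
    by (simp add: sink_poly_def graph_poly_def)
  moreover have "sink_slim {} m (\<lambda>_. 0) {}"
    by (simp add: sink_slim_def)
  ultimately have "1 \<in> sink_slim_space {} m"
    unfolding sink_slim_space_def by (metis (mono_tags, lifting) cvec.span_base mem_Collect_eq)
  then have "c 0 *\<^sub>C 1 \<in> sink_slim_space {} m"
    by (simp add: sink_slim_space_def cvec.span_scale)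
  then show ?case
    by (rule bexI[rotated]) (auto simp: sink_parking_def)
next
  case (isolated S m)
  \<comment> \<open>For I = S every bound is 0, so no exponent qualifies.\<close>
  then have "sink_parking S m = {}"
    by (auto simp: sink_parking_def intro!: exI[of _ S])
  then show ?case
    by (auto simp: sink_slim_space_def intro: cvec.span_zero)
next
  case (step S m i)
  obtain g where g: "g \<in> sink_slim_space (S - {i}) (\<lambda>j. m j + 1)"
    "\<forall>a\<in>sink_parking (S - {i}) (\<lambda>j. m j + 1). lookup g a = c a"
    using step.IH(2) by blast
  obtain f q where f: "f \<in> sink_slim_space S m" "f - g = var i * q"
    using sink_slim_space_lift[of S i m, OF step.hyps g(1)] unfolding dvd_def by blast
  have f_eq: "f = g + var i * q"
    using f(2) by (simp add: algebra_simps)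
  \<comment> \<open>\<open>h\<close> is asked for the error that f still has at exponents divisible
    by x_i.\<close>
  obtain h where h: "h \<in> sink_slim_space S (m(i := m i - 1))"
    "\<forall>a\<in>sink_parking S (m(i := m i - 1)). lookup h a = c (a + unit_exp i) - lookup f (a + unit_exp i)"
    using step.IH(1)[of "\<lambda>a. c (a + unit_exp i) - lookup f (a + unit_exp i)"] by blast
  have "f + var i * h \<in> sink_slim_space S m"
    using f(1) sink_slim_space_var_mult[of S i m, OF step.hyps h(1)]
    by (simp add: sink_slim_space_def cvec.span_add)
  moreover have "lookup (f + var i * h) a = c a" if a: "a \<in> sink_parking S m" for a
  proof (cases a rule: monomial_cases[of _ i])
    case zero
    then show ?thesis
      using a g(2) sink_parking_contract[of S i m, OF step.hyps zero]
      by (simp add: f_eq lookup_add lookup_var_mult_0)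
  next
    case (add a')
    then show ?thesis
      using a h(2) sink_parking_delete[of i S m, OF step.hyps(2,3)]
      by (simp add: lookup_add lookup_var_mult_add)
  qed
  ultimately show ?case by blast
qed

section \<open>Slim subgraphs\<close>

text \<open>The sink hangs on n + 1 by a single edge. Being a bridge, this edge must stay in the
  complement, so the slim subgraphs remain those of the complete graph.\<close>

definition pendant :: "nat \<Rightarrow> nat \<Rightarrow> nat" where
  "pendant n j = (if j = n + 1 then 1 else 0)"

text \<open>A path from I to n + 1 must leave I. Conversely, the component of a vertex that does not
  reach n + 1 would be a set I that no complementary edge leaves.\<close>

lemma slim_iff_cut:
  "slim n G \<longleftrightarrow> G \<subseteq> complete_graph (n + 1) \<and>
     (\<forall>I\<subseteq>{1..n}. I \<noteq> {} \<longrightarrow> (\<exists>i\<in>I. \<exists>j\<in>{1..n + 1} - I. {i, j} \<notin> G))"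
proof (intro iffI conjI allI impI)
  assume slim: "slim n G"
  then show "G \<subseteq> complete_graph (n + 1)"
    by (simp add: slim_def)
  fix I assume I: "I \<subseteq> {1..n}" "I \<noteq> {}"
  show "\<exists>i\<in>I. \<exists>j\<in>{1..n + 1} - I. {i, j} \<notin> G"
  proof (rule ccontr)
    assume closed: "\<not> ?thesis"
    obtain u where u: "u \<in> I" using I by blast
    then have "(u, n + 1) \<in> {(a, b). {a, b} \<in> complete_graph (n + 1) - G}\<^sup>*"
      using slim I by (auto simp: slim_def connected_on_def)
    then have "n + 1 \<in> I"
    proof (induction rule: rtrancl_induct)
      case (step a b)
      then have "b \<in> {1..n + 1}" "{a, b} \<notin> G"
        by (auto simp: complete_graph_def)
      then show ?case
        using closed step.IH by blast
    qed (rule u)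
    then show False using I by auto
  qed
next
  assume G: "G \<subseteq> complete_graph (n + 1) \<and>
     (\<forall>I\<subseteq>{1..n}. I \<noteq> {} \<longrightarrow> (\<exists>i\<in>I. \<exists>j\<in>{1..n + 1} - I. {i, j} \<notin> G))"
  define R where "R = {(a, b). {a, b} \<in> complete_graph (n + 1) - G}"
  have reach: "(u, n + 1) \<in> R\<^sup>*" if u: "u \<in> {1..n + 1}" for u
  proof (rule ccontr)
    assume no: "(u, n + 1) \<notin> R\<^sup>*"
    define C where "C = {v \<in> {1..n + 1}. (u, v) \<in> R\<^sup>*}"
    have "n + 1 \<notin> C" "u \<in> C"
      using no u by (auto simp: C_def)
    then have "C \<subseteq> {1..n}" "C \<noteq> {}"
      by (auto simp: C_def le_Suc_eq)
    then obtain i j where ij: "i \<in> C" "j \<in> {1..n + 1} - C" "{i, j} \<notin> G"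
      using G by blast
    then have "(i, j) \<in> R"
      by (auto simp: R_def C_def complete_graph_def card_2_iff)
    then have "j \<in> C"
      using ij by (auto simp: C_def intro: rtrancl_into_rtrancl)
    then show False using ij by blast
  qed
  have "sym R"
    by (auto simp: R_def sym_def insert_commute)
  then have "(u, v) \<in> R\<^sup>*" if "u \<in> {1..n + 1}" "v \<in> {1..n + 1}" for u v
    using reach[OF that(1)] reach[OF that(2)] by (metis rtrancl_trans symD sym_rtrancl)
  then show "slim n G"
    using G by (auto simp: slim_def connected_on_def R_def)
qed

text \<open>Taking I as the whole vertex set forces the bridge into the complement, so b vanishes.
  Conversely, the free bridge serves every I that contains n + 1, and the others are covered by
  \<open>slim_iff_cut\<close>.\<close>

lemma sink_slim_pendant:
  "sink_slim {1..n + 1} (pendant n) b H \<longleftrightarrow> (\<forall>i\<in>{1..n + 1}. b i = 0) \<and> slim n H"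
proof
  assume s: "sink_slim {1..n + 1} (pendant n) b H"
  then have le: "b i \<le> pendant n i" if "i \<in> {1..n + 1}" for i
    using that unfolding sink_slim_def by blast
  have cut: "(\<exists>i\<in>I. b i < pendant n i) \<or> (\<exists>i\<in>I. \<exists>j\<in>{1..n + 1} - I. {i, j} \<notin> H)"
    if "I \<subseteq> {1..n + 1}" "I \<noteq> {}" for I
    using s that unfolding sink_slim_def by blast
  have "\<exists>i\<in>{1..n + 1}. b i < pendant n i"
    using cut[of "{1..n + 1}"] by auto
  then have "b (n + 1) = 0"
    by (auto simp: pendant_def split: if_splits)
  then have "\<forall>i\<in>{1..n + 1}. b i = 0"
    using le by (fastforce simp: pendant_def split: if_splits)
  moreover have "\<exists>i\<in>I. \<exists>j\<in>{1..n + 1} - I. {i, j} \<notin> H" if "I \<subseteq> {1..n}" "I \<noteq> {}" for I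
  proof -
    have "I \<subseteq> {1..n + 1}" "\<forall>i\<in>I. pendant n i = 0"
      using that by (auto simp: pendant_def)
    then show ?thesis
      using cut[of I] that by auto
  qed
  ultimately show "(\<forall>i\<in>{1..n + 1}. b i = 0) \<and> slim n H"
    using s unfolding slim_iff_cut sink_slim_def complete_graph_def by blast
next
  assume s: "(\<forall>i\<in>{1..n + 1}. b i = 0) \<and> slim n H"
  have "(\<exists>i\<in>I. b i < pendant n i) \<or> (\<exists>i\<in>I. \<exists>j\<in>{1..n + 1} - I. {i, j} \<notin> H)"
    if I: "I \<subseteq> {1..n + 1}" "I \<noteq> {}" for I
  proof (cases "n + 1 \<in> I")
    case True
    then show ?thesis using s by (auto simp: pendant_def)
  next
    case False
    then have "I \<subseteq> {1..n}" using I by (auto simp: le_Suc_eq)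
    then show ?thesis using s I unfolding slim_iff_cut by blast
  qed
  then show "sink_slim {1..n + 1} (pendant n) b H"
    using s by (simp add: sink_slim_def slim_def complete_graph_def)
qed

lemma slim_space_eq_sink: "slim_space n = sink_slim_space {1..n + 1} (pendant n)"
proof -
  have eq: "sink_poly {1..n + 1} b H = graph_poly H" if "\<forall>i\<in>{1..n + 1}. b i = 0" for b H
    using that by (simp add: sink_poly_def)
  have "{graph_poly G |G. slim n G} =
      {sink_poly {1..n + 1} b H |b H. sink_slim {1..n + 1} (pendant n) b H}"
    unfolding sink_slim_pendant
  proof (intro equalityI subsetI)
    fix f assume "f \<in> {graph_poly G |G. slim n G}"
    then obtain G where "f = graph_poly G" "slim n G" by blast
    then show "f \<in> {sink_poly {1..n + 1} b H |b H. (\<forall>i\<in>{1..n + 1}. b i = 0) \<and> slim n H}"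
      using eq[of "\<lambda>_. 0" G] by (intro CollectI exI[of _ "\<lambda>_. 0"] exI[of _ G]) auto
  qed (use eq in blast)
  then show ?thesis
    by (simp only: slim_space_def sink_slim_space_def)
qed

section \<open>Monomials and derivatives of slim products\<close>

lemma finite_complete_graph [simp]: "finite (complete_graph m)"
  by (simp add: complete_graph_def)

lemma slim_finite: "slim n G \<Longrightarrow> finite G"
  unfolding slim_def by (meson finite_complete_graph finite_subset)

lemma slim_edge:
  assumes "slim n G"
  shows "\<forall>e\<in>G. \<exists>u v. e = {u, v} \<and> u < v \<and> u \<in> {1..n + 1} \<and> v \<in> {1..n + 1}"
proof
  fix e assume "e \<in> G"
  then have e: "e \<subseteq> {1..n + 1}" "card e = 2"
    using assms by (auto simp: slim_def complete_graph_def)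
  then obtain u v where uv: "e = {u, v}" "u \<noteq> v"
    by (meson card_2_iff)
  then have "e = {min u v, max u v} \<and> min u v < max u v"
    by (auto simp: min_def max_def)
  then show "\<exists>u v. e = {u, v} \<and> u < v \<and> u \<in> {1..n + 1} \<and> v \<in> {1..n + 1}"
    using e(1) by blast
qed

lemma edge_poly_less: "u < v \<Longrightarrow> edge_poly {u, v} = var u - var v"
  by (simp add: edge_poly_def)

text \<open>A product of linear forms is killed by any power of \<open>D\<^sub>I\<close> exceeding the number of factors
  that \<open>D\<^sub>I\<close> does not kill.\<close>
lemma graph_poly_dir_deriv:
  assumes "finite G" "finite I" "\<forall>e\<in>G. \<exists>u v. e = {u, v} \<and> u < v"
  shows "(dir_deriv I ^^ Suc (card {e \<in> G. card (e \<inter> I) = 1})) (graph_poly G) = 0"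
  using assms(1,3)
proof (induction G)
  case empty
  have "dir_deriv I (1 :: cpoly) = 0"
  proof (rule poly_mapping_eqI)
    fix m :: "nat \<Rightarrow>\<^sub>0 nat"
    have "m + unit_exp j \<noteq> 0" for j
      by (metis add_eq_0_iff_both_eq_0 lookup_add lookup_unit_exp lookup_zero one_neq_zero)
    then show "lookup (dir_deriv I (1 :: cpoly)) m = lookup 0 m"
      by (simp add: lookup_dir_deriv lookup_one)
  qed
  then show ?case by (simp add: graph_poly_def)
next
  case (insert e G)
  then obtain u v where e: "e = {u, v}" "u < v" by blast
  define g where "g = graph_poly G"
  define k where "k = card {e \<in> G. card (e \<inter> I) = 1}"
  have g: "(dir_deriv I ^^ Suc k) g = 0"
    using insert by (simp add: g_def k_def)
  have "(dir_deriv I ^^ d) (graph_poly (insert e G)) =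
      (dir_deriv I ^^ d) (var u * g) + (- 1) *\<^sub>C (dir_deriv I ^^ d) (var v * g)" for d
  proof -
    have "graph_poly (insert e G) = var u * g + (- 1) *\<^sub>C (var v * g)"
      using insert.hyps e by (simp add: graph_poly_def g_def edge_poly_less scaleC_minus_one algebra_simps)
    then show ?thesis
      by (simp only: dir_deriv_pow_add dir_deriv_pow_scaleC)
  qed
  note prod = this[unfolded dir_deriv_pow_var_mult[OF assms(2)]]
  show ?case
  proof (cases "card (e \<inter> I) = 1")
    case True
    then have "{e' \<in> insert e G. card (e' \<inter> I) = 1} = insert e {e \<in> G. card (e \<inter> I) = 1}"
      by auto
    then have card: "card {e' \<in> insert e G. card (e' \<inter> I) = 1} = Suc k"
      using insert.hyps by (simp add: k_def)
    have "(dir_deriv I ^^ Suc (Suc k)) g = 0"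
      by (rule dir_deriv_pow_mono[OF g]) simp
    then show ?thesis
      unfolding card prod using g by (simp only: diff_Suc_1) simp
  next
    case False
    then have "{e' \<in> insert e G. card (e' \<inter> I) = 1} = {e \<in> G. card (e \<inter> I) = 1}"
      by auto
    then have card: "card {e' \<in> insert e G. card (e' \<inter> I) = 1} = k"
      by (simp only: k_def)
    \<comment> \<open>An edge not crossing I has both ends inside or both outside. The Leibniz terms
      of x_u and x_v that involve D_I^k g therefore cancel.\<close>
    have "u \<in> I \<longleftrightarrow> v \<in> I"
      using False e by (auto simp: Int_insert_left)
    then show ?thesis
      unfolding card prod using g by (simp add: scaleC_minus_one del: funpow.simps of_nat_Suc)
  qed
qed

lemma keys_var_mult: "keys (var i * g) = (\<lambda>a. a + unit_exp i) ` keys g"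
proof (intro equalityI subsetI)
  fix a assume "a \<in> keys (var i * g)"
  then show "a \<in> (\<lambda>a. a + unit_exp i) ` keys g"
    by (cases a rule: monomial_cases[of _ i])
      (auto simp: in_keys_iff lookup_var_mult_0 lookup_var_mult_add)
qed (auto simp: in_keys_iff lookup_var_mult_add)

text \<open>Expanding the product picks one end of each edge, so a monomial is built up from 0 in
  \<open>card G\<close> steps. The predicate \<open>P\<close> can carry support and degree through a
  single induction.\<close>

lemma keys_graph_poly_induct:
  assumes "finite G" "\<forall>e\<in>G. \<exists>u v. e = {u, v} \<and> u < v \<and> u \<in> A \<and> v \<in> A"
    and "a \<in> keys (graph_poly G)"
    and zero: "P 0 0" and add: "\<And>k a i. P k a \<Longrightarrow> i \<in> A \<Longrightarrow> P (Suc k) (a + unit_exp i)"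
  shows "P (card G) a"
  using assms(1-3)
proof (induction G arbitrary: a)
  case empty
  then show ?case using zero by (simp add: graph_poly_def)
next
  case (insert e G)
  then obtain u v where e: "e = {u, v}" "u < v" "u \<in> A" "v \<in> A" by blast
  have "graph_poly (insert e G) = var u * graph_poly G - var v * graph_poly G"
    using insert.hyps e by (simp add: graph_poly_def edge_poly_less algebra_simps)
  then have "a \<in> keys (var u * graph_poly G) \<or> a \<in> keys (var v * graph_poly G)"
    using insert.prems(2) by (auto simp: in_keys_iff lookup_minus)
  then show ?case
    using insert e add by (auto simp: keys_var_mult)
qed

lemma keys_add_unit_exp: "keys (a + unit_exp i) = insert i (keys a)"
  by (auto simp: in_keys_iff lookup_add lookup_unit_exp split: if_splits)

lemma monom_degree_superset:
  assumes "finite A" "keys a \<subseteq> A"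
  shows "monom_degree a = sum (lookup a) A"
  unfolding monom_degree_def using assms
  by (intro sum.mono_neutral_left) (auto simp: in_keys_iff)

lemma monom_degree_add_unit_exp: "monom_degree (a + unit_exp i) = Suc (monom_degree a)"
proof -
  define A where "A = insert i (keys a)"
  have "monom_degree (a + unit_exp i) = sum (lookup (a + unit_exp i)) A"
    by (rule monom_degree_superset) (auto simp: A_def keys_add_unit_exp)
  also have "\<dots> = sum (lookup a) A + 1"
    by (simp add: lookup_add lookup_unit_exp sum.distrib A_def)
  also have "sum (lookup a) A = monom_degree a"
    by (rule monom_degree_superset[symmetric]) (auto simp: A_def)
  finally show ?thesis by simp
qed

lemma slim_keys_graph_poly:
  assumes "slim n G" "a \<in> keys (graph_poly G)"
  shows "keys a \<subseteq> {1..n + 1} \<and> monom_degree a = card G"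
  using slim_finite[OF assms(1)] slim_edge[OF assms(1)] assms(2)
proof (rule keys_graph_poly_induct[where P = "\<lambda>k a. keys a \<subseteq> {1..n + 1} \<and> monom_degree a = k"
      and A = "{1..n + 1}"])
qed (simp_all add: monom_degree_def[of 0] keys_add_unit_exp monom_degree_add_unit_exp)

text \<open>Strictness comes from one edge that leaves I and is not in G: the bridge if n + 1 is in
  I, and otherwise one supplied by slimness. It makes room for the extra derivative in
  \<open>graph_poly_dir_deriv\<close>.\<close>

lemma slim_crossing_card:
  assumes "slim n G" "I \<subseteq> {1..n + 1}" "I \<noteq> {}"
  shows "card {e \<in> G. card (e \<inter> I) = 1} < cut_size {1..n + 1} (pendant n) I"
proof -
  define X where "X = (\<lambda>(i, j). {i, j}) ` (I \<times> ({1..n + 1} - I))"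
  have fI: "finite I" using assms finite_subset by blast
  have sub: "{e \<in> G. card (e \<inter> I) = 1} \<subseteq> X"
  proof
    fix e assume "e \<in> {e \<in> G. card (e \<inter> I) = 1}"
    then have e: "e \<in> G" "card (e \<inter> I) = 1" by auto
    obtain u v where uv: "e = {u, v}" "u < v" "u \<in> {1..n + 1}" "v \<in> {1..n + 1}"
      using slim_edge[OF assms(1)] e(1) by blast
    consider "u \<in> I" "v \<notin> I" | "u \<notin> I" "v \<in> I"
      using e(2) uv by (auto simp: Int_insert_left split: if_splits)
    then show "e \<in> X"
    proof cases
      case 1
      then show ?thesis unfolding X_def using uv by (intro image_eqI[of _ _ "(u, v)"]) auto
    next
      case 2
      then show ?thesis unfolding X_def using uv by (intro image_eqI[of _ _ "(v, u)"]) auto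
    qed
  qed
  have fX: "finite X" using fI by (simp add: X_def)
  have "card X \<le> card (I \<times> ({1..n + 1} - I))"
    unfolding X_def by (rule card_image_le) (use fI in auto)
  then have cX: "card X \<le> card I * card ({1..n + 1} - I)"
    by (simp add: card_cartesian_product)
  show ?thesis
  proof (cases "n + 1 \<in> I")
    case True
    then have "sum (pendant n) I > 0"
      using fI by (auto simp: pendant_def intro!: sum_pos2[of I "n + 1"])
    then show ?thesis
      using card_mono[OF fX sub] cX by (simp add: cut_size_def)
  next
    case False
    then have "I \<subseteq> {1..n}" using assms by (auto simp: le_Suc_eq)
    then obtain i j where "i \<in> I" "j \<in> {1..n + 1} - I" "{i, j} \<notin> G"
      using assms unfolding slim_iff_cut by blast
    then have "{i, j} \<in> X - {e \<in> G. card (e \<inter> I) = 1}"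
      by (auto simp: X_def)
    then have "{e \<in> G. card (e \<inter> I) = 1} \<subset> X"
      using sub by blast
    then have "card {e \<in> G. card (e \<inter> I) = 1} < card X"
      by (rule psubset_card_mono[OF fX])
    then show ?thesis
      using cX by (simp add: cut_size_def)
  qed
qed

text \<open>One more application of D_I than there are factors crossing I kills a generator, and by
  \<open>slim_crossing_card\<close> that number does not exceed the cut size. So injectivity carries
  over to V_n.\<close>

lemma slim_space_subset_cut_power_space:
  assumes "f \<in> slim_space n"
  shows "f \<in> cut_power_space {1..n + 1} (pendant n)"
  using assms unfolding slim_space_def
proof (induction rule: cvec.span_induct_alt)
  case base
  then show ?case by (simp add: cut_power_space_def)
next
  case (step c x y)
  then obtain G where x: "x = graph_poly G" "slim n G" by blast
  have "(dir_deriv I ^^ cut_size {1..n + 1} (pendant n) I) (c *\<^sub>C x + y) = 0"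
    if I: "I \<subseteq> {1..n + 1}" "I \<noteq> {}" for I
  proof -
    have "finite I" using I finite_subset by blast
    moreover have "\<forall>e\<in>G. \<exists>u v. e = {u, v} \<and> u < v"
      using slim_edge[OF x(2)] by blast
    ultimately have "(dir_deriv I ^^ Suc (card {e \<in> G. card (e \<inter> I) = 1})) x = 0"
      unfolding x(1) by (intro graph_poly_dir_deriv slim_finite[OF x(2)])
    then have "(dir_deriv I ^^ cut_size {1..n + 1} (pendant n) I) x = 0"
      by (rule dir_deriv_pow_mono) (use slim_crossing_card[OF x(2) I] in simp)
    moreover have "(dir_deriv I ^^ cut_size {1..n + 1} (pendant n) I) y = 0"
      using step.IH I unfolding cut_power_space_def by blast
    ultimately show ?thesis
      by (simp add: dir_deriv_pow_add dir_deriv_pow_scaleC)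
  qed
  moreover have "keys a \<subseteq> {1..n + 1}" if "a \<in> keys (c *\<^sub>C x + y)" for a
  proof -
    have "a \<in> keys x \<or> a \<in> keys y"
      using that by (auto simp: in_keys_iff lookup_add)
    then show ?thesis
      using slim_keys_graph_poly[OF x(2)] step.IH unfolding x(1) cut_power_space_def by blast
  qed
  ultimately show ?case
    unfolding cut_power_space_def by blast
qed

text \<open>Exponent vectors of parking functions, shifted so that the values start at \<open>0\<close>.\<close>
definition park_exp :: "nat \<Rightarrow> (nat \<Rightarrow>\<^sub>0 nat) set" where
  "park_exp n = {a. keys a \<subseteq> {1..n} \<and> (\<forall>I\<subseteq>{1..n}. I \<noteq> {} \<longrightarrow> (\<exists>i\<in>I. lookup a i + card I \<le> n))}"

text \<open>The condition for I = {1..n + 1} forces exponent 0 at n + 1. For I inside {1..n} there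
  are n + 1 - card I vertices outside, so the strict bound becomes
  \<open>lookup a i + card I \<le> n\<close>.\<close>

lemma sink_parking_pendant: "sink_parking {1..n + 1} (pendant n) = park_exp n"
proof (intro equalityI subsetI)
  fix a assume a: "a \<in> sink_parking {1..n + 1} (pendant n)"
  then have cut: "\<exists>i\<in>I. lookup a i < pendant n i + card ({1..n + 1} - I)"
    if "I \<subseteq> {1..n + 1}" "I \<noteq> {}" for I
    using that unfolding sink_parking_def by blast
  have "lookup a (n + 1) = 0"
    using cut[of "{1..n + 1}"] by (auto simp: pendant_def split: if_splits)
  then have "n + 1 \<notin> keys a"
    by (simp add: in_keys_iff)
  then have "keys a \<subseteq> {1..n + 1} - {n + 1}"
    using a unfolding sink_parking_def by blast
  then have "keys a \<subseteq> {1..n}" by (auto simp: le_Suc_eq)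
  moreover have "\<exists>i\<in>I. lookup a i + card I \<le> n" if I: "I \<subseteq> {1..n}" "I \<noteq> {}" for I
  proof -
    have "I \<subseteq> {1..n + 1}" using I by auto
    then obtain i where i: "i \<in> I" "lookup a i < pendant n i + card ({1..n + 1} - I)"
      using cut I by blast
    moreover have "card ({1..n + 1} - I) = n + 1 - card I"
      using \<open>I \<subseteq> {1..n + 1}\<close> by (simp add: card_Diff_subset finite_subset)
    moreover have "pendant n i = 0"
      using i I by (auto simp: pendant_def)
    ultimately show ?thesis by (intro bexI[of _ i]) auto
  qed
  ultimately show "a \<in> park_exp n"
    unfolding park_exp_def by blast
next
  fix a assume a: "a \<in> park_exp n"
  then have keys: "keys a \<subseteq> {1..n}"
    unfolding park_exp_def by blast
  have "\<exists>i\<in>I. lookup a i < pendant n i + card ({1..n + 1} - I)"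
    if I: "I \<subseteq> {1..n + 1}" "I \<noteq> {}" for I
  proof (cases "n + 1 \<in> I")
    case True
    have "lookup a (n + 1) = 0"
      using keys by (auto simp flip: not_in_keys_iff_lookup_eq_zero)
    then show ?thesis
      using True by (intro bexI[of _ "n + 1"]) (auto simp: pendant_def)
  next
    case False
    then have "I \<subseteq> {1..n}" using I by (auto simp: le_Suc_eq)
    then obtain i where i: "i \<in> I" "lookup a i + card I \<le> n"
      using a I unfolding park_exp_def by blast
    moreover have "card ({1..n + 1} - I) = n + 1 - card I"
      using I by (simp add: card_Diff_subset finite_subset)
    ultimately show ?thesis by (intro bexI[of _ i]) auto
  qed
  moreover have "keys a \<subseteq> {1..n + 1}"
    using keys by auto
  ultimately show "a \<in> sink_parking {1..n + 1} (pendant n)"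
    unfolding sink_parking_def by blast
qed

section \<open>The coefficient map on V_n and the grading\<close>

lemma slim_space_eq_0:
  assumes "f \<in> slim_space n" "\<forall>a\<in>park_exp n. lookup f a = 0"
  shows "f = 0"
  by (rule cut_power_space_eq_0[OF _ slim_space_subset_cut_power_space[OF assms(1)]])
    (use assms(2) in \<open>simp_all only: sink_parking_pendant finite_atLeastAtMost\<close>)

lemma slim_space_interpolate: "\<exists>f\<in>slim_space n. \<forall>a\<in>park_exp n. lookup f a = c a"
  using sink_slim_space_interpolate[of "{1..n + 1}" "pendant n" c]
  unfolding slim_space_eq_sink sink_parking_pendant by blast

definition homogeneous_part :: "nat \<Rightarrow> cpoly \<Rightarrow> cpoly" where
  "homogeneous_part k = restrict_poly (\<lambda>a. monom_degree a = k)"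

lemma lookup_homogeneous_part [simp]:
  "lookup (homogeneous_part k f) a = (if monom_degree a = k then lookup f a else 0)"
  by (simp add: homogeneous_part_def)

lemma homogeneous_iff_lookup: "homogeneous k f \<longleftrightarrow> (\<forall>a. monom_degree a \<noteq> k \<longrightarrow> lookup f a = 0)"
  by (auto simp: homogeneous_def in_keys_iff)

text \<open>The generators are homogeneous, of degree \<open>card G\<close>, so projection to degree
  k keeps each of them or kills it.\<close>

lemma homogeneous_part_slim_component:
  assumes "f \<in> slim_space n"
  shows "homogeneous_part k f \<in> slim_component n k"
proof -
  have "homogeneous_part k f \<in> slim_space n"
    using assms unfolding slim_space_def[of n]
  proof (induction rule: cvec.span_induct_alt)
    case base
    have "homogeneous_part k 0 = 0"
      by (rule poly_mapping_eqI) simp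
    then show ?case by (simp add: cvec.span_zero)
  next
    case (step c x y)
    then obtain G where x: "x = graph_poly G" "slim n G" by blast
    have "lookup x a = 0" if "monom_degree a \<noteq> card G" for a
      using slim_keys_graph_poly[OF x(2), of a] that unfolding x(1) in_keys_iff by blast
    then have "homogeneous_part k x = (if card G = k then x else 0)"
      by (intro poly_mapping_eqI) auto
    then have "homogeneous_part k x \<in> cvec.span {graph_poly G |G. slim n G}"
      using step(1) by (simp add: cvec.span_zero cvec.span_base)
    moreover have "homogeneous_part k (c *\<^sub>C x + y) = c *\<^sub>C homogeneous_part k x + homogeneous_part k y"
      by (rule poly_mapping_eqI) (simp add: lookup_add)
    ultimately show ?case
      using step.IH by (simp add: cvec.span_add cvec.span_scale)
  qed
  then show ?thesis
    by (simp add: slim_component_def homogeneous_iff_lookup)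
qed

lemma slim_component_interpolate:
  assumes "\<And>a. monom_degree a \<noteq> k \<Longrightarrow> c a = 0"
  shows "\<exists>f\<in>slim_component n k. \<forall>a\<in>park_exp n. lookup f a = c a"
proof -
  obtain f where "f \<in> slim_space n" "\<forall>a\<in>park_exp n. lookup f a = c a"
    using slim_space_interpolate by blast
  then show ?thesis
    using assms by (intro bexI[OF _ homogeneous_part_slim_component]) auto
qed

lemma subspace_slim_space: "cvec.subspace (slim_space n)"
  by (simp add: slim_space_def)

lemma subspace_slim_component: "cvec.subspace (slim_component n k)"
  using subspace_slim_space[of n]
  by (auto simp: cvec.subspace_def slim_component_def homogeneous_iff_lookup lookup_add)

lemma slim_space_internal_direct_sum: "internal_direct_sum (slim_space n) (slim_component n)"
  unfolding internal_direct_sum_def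
proof (intro conjI allI ballI)
  fix k
  show "cvec.subspace (slim_component n k)" "slim_component n k \<subseteq> slim_space n"
    by (rule subspace_slim_component) (simp add: slim_component_def)
next
  fix f assume f: "f \<in> slim_space n"
  show "\<exists>!c. (\<forall>k. c k \<in> slim_component n k) \<and> finite {k. c k \<noteq> 0} \<and> f = (\<Sum>k | c k \<noteq> 0. c k)"
  proof (rule ex1I[of _ "\<lambda>k. homogeneous_part k f"])
    have sub: "{k. homogeneous_part k f \<noteq> 0} \<subseteq> monom_degree ` keys f"
    proof
      fix k assume "k \<in> {k. homogeneous_part k f \<noteq> 0}"
      then obtain a where "lookup (homogeneous_part k f) a \<noteq> 0"
        by (metis lookup_zero mem_Collect_eq poly_mapping_eqI)
      then show "k \<in> monom_degree ` keys f"
        by (auto simp: in_keys_iff split: if_splits)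
    qed
    then have fin: "finite {k. homogeneous_part k f \<noteq> 0}"
      by (rule finite_subset) simp
    have "f = (\<Sum>k | homogeneous_part k f \<noteq> 0. homogeneous_part k f)"
    proof (rule poly_mapping_eqI)
      fix a
      have "lookup f a = 0" if "homogeneous_part (monom_degree a) f = 0"
        using arg_cong[OF that, of "\<lambda>p. lookup p a"] by simp
      then show "lookup f a = lookup (\<Sum>k | homogeneous_part k f \<noteq> 0. homogeneous_part k f) a"
        using fin by (auto simp: lookup_sum sum.delta)
    qed
    then show "(\<forall>k. homogeneous_part k f \<in> slim_component n k) \<and>
        finite {k. homogeneous_part k f \<noteq> 0} \<and>
        f = (\<Sum>k | homogeneous_part k f \<noteq> 0. homogeneous_part k f)"
      using f fin homogeneous_part_slim_component by blast
  next
    fix c assume c: "(\<forall>k. c k \<in> slim_component n k) \<and> finite {k. c k \<noteq> 0} \<and> f = (\<Sum>k | c k \<noteq> 0. c k)"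
    show "c = (\<lambda>k. homogeneous_part k f)"
    proof (rule ext, rule poly_mapping_eqI)
      fix k a
      \<comment> \<open>A component \<open>c j\<close> has only monomials of degree j, so the
        coefficient of f at a comes from the single index \<open>monom_degree a\<close>.\<close>
      have hom: "lookup (c j) a = (if j = monom_degree a then lookup (c j) a else 0)" for j
        using c by (auto simp: slim_component_def homogeneous_iff_lookup)
      have "lookup f a = (\<Sum>j | c j \<noteq> 0. lookup (c j) a)"
        using c by (metis (no_types) lookup_sum)
      also have "\<dots> = (\<Sum>j | c j \<noteq> 0. if j = monom_degree a then lookup (c j) a else 0)"
        by (intro sum.cong refl hom)
      also have "\<dots> = lookup (c (monom_degree a)) a"
        using c by (simp add: sum.delta')
      finally show "lookup (c k) a = lookup (homogeneous_part k f) a"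
        using hom[of k] by (auto split: if_splits)
    qed
  qed
qed

section \<open>The symmetric group action and the parking space\<close>

lemma lookup_push_bij:
  assumes "bij \<phi>"
  shows "lookup (push \<phi> f) b = lookup f (inv' \<phi> b)"
proof -
  have "\<phi> a = b \<longleftrightarrow> a = inv' \<phi> b" for a
    using assms by (metis bij_inv_eq_iff)
  then have "lookup (push \<phi> f) b = (\<Sum>a\<in>keys f. if a = inv' \<phi> b then lookup f a else 0)"
    by (simp add: push_def lookup_sum lookup_single when_def)
  then show ?thesis
    by (simp add: sum.delta in_keys_iff)
qed

lemma lookup_push_inv: "bij w \<Longrightarrow> lookup (push (inv' w) m) i = lookup m (w i)"
  by (simp add: lookup_push_bij bij_imp_bij_inv inv_inv_eq)

lemma bij_push:
  fixes w :: "'a \<Rightarrow> 'a"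
  assumes "bij w"
  shows "bij (push w :: ('a \<Rightarrow>\<^sub>0 'b::comm_monoid_add) \<Rightarrow> _)"
    and "inv' (push w :: ('a \<Rightarrow>\<^sub>0 'b) \<Rightarrow> _) = push (inv' w)"
proof -
  have 1: "push (inv' w) (push w m) = m" for m :: "'a \<Rightarrow>\<^sub>0 'b"
    using assms by (intro poly_mapping_eqI) (simp add: lookup_push_inv lookup_push_bij bij_is_inj)
  have 2: "push w (push (inv' w) m) = m" for m :: "'a \<Rightarrow>\<^sub>0 'b"
    using assms by (intro poly_mapping_eqI) (simp add: lookup_push_inv lookup_push_bij bij_is_surj surj_f_inv_f)
  show "bij (push w :: ('a \<Rightarrow>\<^sub>0 'b) \<Rightarrow> _)"
    using 1 2 by (metis bijI')
  show "inv' (push w :: ('a \<Rightarrow>\<^sub>0 'b) \<Rightarrow> _) = push (inv' w)"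
    by (rule inv_equality) (fact 1 2)+
qed

text \<open>Coefficients are moved by the inverse of w on exponents, and
  \<open>push (inv' w) m\<close> is m composed with w by \<open>lookup_push_inv\<close>. The
  algebraic properties of the action are checked in this form.\<close>

lemma lookup_permute_vars: "bij w \<Longrightarrow> lookup (permute_vars w f) m = lookup f (push (inv' w) m)"
  by (simp add: permute_vars_def lookup_push_bij bij_push)

lemma permute_vars_add: "bij w \<Longrightarrow> permute_vars w (f + g) = permute_vars w f + permute_vars w g"
  by (rule poly_mapping_eqI) (simp add: lookup_permute_vars lookup_add)

lemma permute_vars_scaleC: "bij w \<Longrightarrow> permute_vars w (c *\<^sub>C f) = c *\<^sub>C permute_vars w f"
  by (rule poly_mapping_eqI) (simp add: lookup_permute_vars)

lemma permute_vars_var_mult: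
  assumes "bij w"
  shows "permute_vars w (var i * g) = var (w i) * permute_vars w g"
proof (rule poly_mapping_eqI)
  fix m :: "nat \<Rightarrow>\<^sub>0 nat"
  show "lookup (permute_vars w (var i * g)) m = lookup (var (w i) * permute_vars w g) m"
  proof (cases m rule: monomial_cases[of _ "w i"])
    case zero
    then show ?thesis
      using assms by (simp add: lookup_permute_vars lookup_var_mult_0 lookup_push_inv)
  next
    case (add m')
    have "push (inv' w) (m' + unit_exp (w i)) = push (inv' w) m' + unit_exp i"
      using assms
      by (intro poly_mapping_eqI) (auto simp: lookup_push_inv lookup_add lookup_unit_exp bij_is_inj inj_eq)
    then show ?thesis
      using assms by (simp add: add lookup_permute_vars lookup_var_mult_add)
  qed
qed

lemma permute_vars_1:
  assumes "bij w"
  shows "permute_vars w 1 = 1"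
proof (rule poly_mapping_eqI)
  fix m :: "nat \<Rightarrow>\<^sub>0 nat"
  have "push (inv' w) m = 0 \<longleftrightarrow> m = 0"
    using assms by (metis bij_imp_bij_inv bij_is_inj bij_push(1) inj_eq lookup_push_inv lookup_zero poly_mapping_eqI)
  then show "lookup (permute_vars w 1) m = lookup 1 m"
    using assms by (simp add: lookup_permute_vars lookup_one)
qed

lemma permute_vars_id: "permute_vars id f = f"
proof (rule poly_mapping_eqI)
  fix m :: "nat \<Rightarrow>\<^sub>0 nat"
  have "push (inv' id) m = m"
    using lookup_push_inv[OF bij_id, of m] by (intro poly_mapping_eqI) simp
  then show "lookup (permute_vars id f) m = lookup f m"
    using lookup_permute_vars[OF bij_id, of f m] by simp
qed

lemma permute_vars_comp:
  assumes "bij v" "bij w"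
  shows "permute_vars (v \<circ> w) f = permute_vars v (permute_vars w f)"
proof (rule poly_mapping_eqI)
  fix m :: "nat \<Rightarrow>\<^sub>0 nat"
  have "push (inv' (v \<circ> w)) m = push (inv' w) (push (inv' v) m)"
    using assms by (intro poly_mapping_eqI) (simp add: lookup_push_inv bij_comp)
  then show "lookup (permute_vars (v \<circ> w) f) m = lookup (permute_vars v (permute_vars w f)) m"
    using assms by (simp add: lookup_permute_vars bij_comp)
qed

text \<open>Renaming vertices may reverse the order of the ends of an edge, hence the sign. A span
  is not affected by it.\<close>

lemma permute_vars_graph_poly:
  assumes "bij w" "finite G" "\<forall>e\<in>G. \<exists>u v. e = {u, v} \<and> u < v"
  shows "permute_vars w (graph_poly G) = graph_poly ((`) w ` G) \<or>
    permute_vars w (graph_poly G) = - graph_poly ((`) w ` G)"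
  using assms(2,3)
proof (induction G)
  case empty
  then show ?case using assms(1) by (simp add: graph_poly_def permute_vars_1)
next
  case (insert e G)
  then obtain u v where e: "e = {u, v}" "u < v" by blast
  have "graph_poly (insert e G) = var u * graph_poly G + (- 1) *\<^sub>C (var v * graph_poly G)"
    using insert.hyps e by (simp add: graph_poly_def edge_poly_less scaleC_minus_one algebra_simps)
  then have "permute_vars w (graph_poly (insert e G)) =
      var (w u) * permute_vars w (graph_poly G) + (- 1) *\<^sub>C (var (w v) * permute_vars w (graph_poly G))"
    using assms(1) by (simp only: permute_vars_add permute_vars_scaleC permute_vars_var_mult)
  then have p: "permute_vars w (graph_poly (insert e G)) =
      (var (w u) - var (w v)) * permute_vars w (graph_poly G)"
    by (simp add: scaleC_minus_one algebra_simps)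
  have "w ` e \<notin> (`) w ` G"
    using insert.hyps assms(1) by (auto simp: bij_is_inj inj_image_eq_iff)
  then have q: "graph_poly ((`) w ` insert e G) = edge_poly {w u, w v} * graph_poly ((`) w ` G)"
    using insert.hyps e by (simp add: graph_poly_def)
  have IH: "permute_vars w (graph_poly G) = graph_poly ((`) w ` G) \<or>
      permute_vars w (graph_poly G) = - graph_poly ((`) w ` G)"
    using insert by blast
  show ?case
    unfolding p q using edge_poly_sym[of "w u" "w v"] IH
    by (elim disjE) (simp_all only: left_diff_distrib mult_minus_right, simp_all)
qed

text \<open>w is an automorphism of the complete graph, so it carries paths in the complement of G
  to paths in the complement of the image.\<close>

lemma slim_image:
  assumes "slim n G" and w: "w permutes {1..n + 1}"
  shows "slim n ((`) w ` G)"
proof -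
  have inj: "inj w" using w by (rule permutes_inj)
  have w_edge: "w ` e \<in> complete_graph (n + 1)" if "e \<in> complete_graph (n + 1)" for e
  proof -
    have "card (w ` e) = card e"
      by (rule card_image) (use inj in \<open>auto intro: inj_on_subset\<close>)
    moreover have "w ` e \<subseteq> w ` {1..n + 1}"
      using that by (intro image_mono) (auto simp: complete_graph_def)
    ultimately show ?thesis
      using that permutes_image[OF w] by (auto simp: complete_graph_def)
  qed
  define R where "R = {(a, b). {a, b} \<in> complete_graph (n + 1) - G}"
  define R' where "R' = {(a, b). {a, b} \<in> complete_graph (n + 1) - (`) w ` G}"
  have step: "(w a, w b) \<in> R'" if "(a, b) \<in> R" for a b
  proof -
    have "w ` {a, b} \<in> complete_graph (n + 1)" "w ` {a, b} \<notin> (`) w ` G"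
      using that w_edge inj by (auto simp: R_def inj_image_eq_iff simp del: image_insert)
    then show ?thesis by (simp add: R'_def)
  qed
  have "(u, v) \<in> R'\<^sup>*" if uv: "u \<in> {1..n + 1}" "v \<in> {1..n + 1}" for u v
  proof -
    obtain u' v' where "u' \<in> {1..n + 1}" "v' \<in> {1..n + 1}" and eq: "u = w u'" "v = w v'"
      using uv permutes_image[OF w] by (metis imageE)
    then have "(u', v') \<in> R\<^sup>*"
      using assms(1) unfolding slim_def connected_on_def R_def by blast
    then show ?thesis
      unfolding eq by (induction rule: rtrancl_induct) (auto intro: rtrancl_into_rtrancl step)
  qed
  moreover have "(`) w ` G \<subseteq> complete_graph (n + 1)"
    using assms(1) w_edge by (auto simp: slim_def)
  ultimately show ?thesis
    unfolding slim_def connected_on_def R'_def by blast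
qed

lemma permute_vars_slim_space:
  assumes w: "w permutes {1..n + 1}" and "f \<in> slim_space n"
  shows "permute_vars w f \<in> slim_space n"
  using assms(2) unfolding slim_space_def[of n]
proof (induction rule: cvec.span_induct_alt)
  case base
  have "permute_vars w 0 = 0"
    by (simp add: permute_vars_def push_def)
  then show ?case by (simp add: cvec.span_zero)
next
  case (step c x y)
  have bij: "bij w" using w by (rule permutes_bij)
  from step obtain G where x: "x = graph_poly G" "slim n G" by blast
  have "graph_poly ((`) w ` G) \<in> cvec.span {graph_poly G |G. slim n G}"
    using slim_image[OF x(2) w] by (intro cvec.span_base) blast
  moreover have "\<forall>e\<in>G. \<exists>u v. e = {u, v} \<and> u < v"
    using slim_edge[OF x(2)] by blast
  then have "permute_vars w x = graph_poly ((`) w ` G) \<or> permute_vars w x = - graph_poly ((`) w ` G)"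
    unfolding x(1) by (rule permute_vars_graph_poly[OF bij slim_finite[OF x(2)]])
  ultimately have "permute_vars w x \<in> cvec.span {graph_poly G |G. slim n G}"
    by (elim disjE) (simp_all only: cvec.span_neg)
  then show ?case
    using step.IH bij by (simp add: permute_vars_add permute_vars_scaleC cvec.span_add cvec.span_scale)
qed

lemma monom_degree_push_inv:
  assumes "bij w"
  shows "monom_degree (push (inv' w) m) = monom_degree m"
proof -
  have keys: "keys m = w ` keys (push (inv' w) m)"
  proof (intro equalityI subsetI)
    fix i assume "i \<in> keys m"
    then show "i \<in> w ` keys (push (inv' w) m)"
      using assms by (intro image_eqI[of _ _ "inv' w i"])
        (auto simp: in_keys_iff lookup_push_inv bij_is_surj surj_f_inv_f)
  qed (use assms in \<open>auto simp: in_keys_iff lookup_push_inv\<close>)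
  have "inj_on w A" for A
    using assms by (meson bij_is_inj inj_on_subset subset_UNIV)
  then show ?thesis
    using assms unfolding monom_degree_def keys by (simp add: sum.reindex lookup_push_inv)
qed

lemma permute_vars_slim_component:
  assumes "w permutes {1..n + 1}" "f \<in> slim_component n k"
  shows "permute_vars w f \<in> slim_component n k"
  using assms permute_vars_slim_space[of w n f] permutes_bij[OF assms(1)]
  by (auto simp: slim_component_def homogeneous_iff_lookup lookup_permute_vars monom_degree_push_inv)

section \<open>The representations on V_n and their restriction to S_n\<close>

lemma permute_vars_is_rep:
  assumes "cvec.subspace V" "\<And>w f. w permutes {1..N} \<Longrightarrow> f \<in> V \<Longrightarrow> permute_vars w f \<in> V"
  shows "is_rep \<lparr>rgroup = sym_group N, rspace = V, ract = permute_vars\<rparr>"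
  using assms
  by (auto simp: is_rep_def sym_group_is_group sym_group_carrier sym_group_one sym_group_mult
      permutes_bij permute_vars_add permute_vars_scaleC permute_vars_id permute_vars_comp)

lemma permutes_Suc: "w permutes {1..n} \<Longrightarrow> w permutes {1..n + 1}" for n :: nat
  by (erule permutes_subset) auto

lemma is_rep_slim_rep: "is_rep (slim_rep n)"
  unfolding slim_rep_def
  by (intro permute_vars_is_rep subspace_slim_space permute_vars_slim_space)

lemma is_rep_slim_component_rep: "is_rep (slim_component_rep n k)"
  unfolding slim_component_rep_def
  by (intro permute_vars_is_rep subspace_slim_component permute_vars_slim_component)

text \<open>The groups \<open>sym_group n\<close> and \<open>sym_group N\<close> differ only in
  their carriers, so shrinking the carrier already gives the restriction to permutations of the
  first n letters.\<close>

lemma res_sym_group: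
  "res_rep (carrier (sym_group n)) \<lparr>rgroup = sym_group N, rspace = V, ract = r\<rparr> =
     \<lparr>rgroup = sym_group n, rspace = V, ract = r\<rparr>"
  by (simp add: res_rep_def sym_group_def)

lemma rep_isoI:
  assumes "is_rep R" "is_rep S" "rgroup R = rgroup S" "bij_betw \<phi> (rspace R) (rspace S)"
    and "\<And>u v. \<phi> (u + v) = \<phi> u + \<phi> v" "\<And>c v. \<phi> (c *\<^sub>C v) = c *\<^sub>C \<phi> v"
    and "\<And>g v. g \<in> carrier (rgroup R) \<Longrightarrow> v \<in> rspace R \<Longrightarrow> \<phi> (ract R g v) = ract S g (\<phi> v)"
  shows "R \<cong>\<^sub>r S"
  unfolding rep_iso_def using assms by blast

definition exp_of :: "nat \<Rightarrow> (nat \<Rightarrow> nat) \<Rightarrow> (nat \<Rightarrow>\<^sub>0 nat)" where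
  "exp_of n g = Abs_poly_mapping (\<lambda>i. if i \<in> {1..n} then g i else 0)"

lemma lookup_exp_of [simp]: "lookup (exp_of n g) i = (if i \<in> {1..n} then g i else 0)"
proof -
  have "finite {i. (if i \<in> {1..n} then g i else 0) \<noteq> 0}"
    by (rule finite_subset[of _ "{1..n}"]) auto
  then show ?thesis
    unfolding exp_of_def by (subst lookup_Abs_poly_mapping) auto
qed

text \<open>On exponents the action is precomposition with w. Parking functions and fillings of a
  Dyck path are moved in the same way, which yields equivariance of both isomorphisms.\<close>

lemma push_inv_exp_of:
  assumes "w permutes {1..n}"
  shows "push (inv' w) (exp_of n g) = exp_of n (g \<circ> w)"
  using permutes_bij[OF assms] permutes_in_image[OF assms]
  by (intro poly_mapping_eqI) (simp add: lookup_push_inv)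

section \<open>Sorted sequences and conditions on subsets\<close>

lemma sorted_nth_le_iff:
  fixes ys :: "'a::linorder list"
  assumes "sorted ys" "k < length ys"
  shows "ys ! k \<le> v \<longleftrightarrow> k < length (filter (\<lambda>x. x \<le> v) ys)"
proof
  assume "ys ! k \<le> v"
  then have "{..k} \<subseteq> {i. i < length ys \<and> ys ! i \<le> v}"
    using assms by (auto intro: order_trans sorted_nth_mono)
  then have "card {..k} \<le> length (filter (\<lambda>x. x \<le> v) ys)"
    unfolding length_filter_conv_card by (intro card_mono) auto
  then show "k < length (filter (\<lambda>x. x \<le> v) ys)" by simp
next
  assume less: "k < length (filter (\<lambda>x. x \<le> v) ys)"
  show "ys ! k \<le> v"
  proof (rule ccontr)
    assume "\<not> ys ! k \<le> v"
    then have "{i. i < length ys \<and> ys ! i \<le> v} \<subseteq> {..<k}"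
      using assms by (auto simp: not_le) (meson leD le_less_trans not_le_imp_less order_trans sorted_nth_mono)
    then have "length (filter (\<lambda>x. x \<le> v) ys) \<le> card {..<k}"
      unfolding length_filter_conv_card by (intro card_mono) auto
    then show False using less by simp
  qed
qed

text \<open>Both sides say that, for each h < n, more than h entries are at most h + c. A set I
  violating the right side leaves too few such entries for h = n - card I; if there are too few for
  some h, the entries above h + c form a violating I. The offset c is 0 for exponents and 1 for
  parking functions.\<close>

lemma sort_nth_le_iff_cut:
  fixes a :: "nat \<Rightarrow> nat"
  shows "(\<forall>h<n. sort (map a [1..<n + 1]) ! h \<le> h + c) \<longleftrightarrow>
    (\<forall>I\<subseteq>{1..n}. I \<noteq> {} \<longrightarrow> (\<exists>i\<in>I. a i + card I \<le> n + c))"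
proof -
  define L where "L = (\<lambda>v. {i \<in> {1..n}. a i \<le> v})"
  have "length (filter (\<lambda>x. x \<le> v) (sort (map a [1..<n + 1]))) = card (L v)" for v
  proof -
    have "length (filter (\<lambda>x. x \<le> v) (sort (map a [1..<n + 1]))) =
        length (filter (\<lambda>i. a i \<le> v) [1..<n + 1])"
      by (simp add: filter_sort filter_map comp_def del: upt_Suc)
    also have "\<dots> = card (set (filter (\<lambda>i. a i \<le> v) [1..<n + 1]))"
      by (rule distinct_card[symmetric]) simp
    also have "set (filter (\<lambda>i. a i \<le> v) [1..<n + 1]) = L v"
      by (auto simp: L_def)
    finally show ?thesis .
  qed
  then have "(\<forall>h<n. sort (map a [1..<n + 1]) ! h \<le> h + c) \<longleftrightarrow> (\<forall>h<n. h < card (L (h + c)))"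
    by (simp add: sorted_nth_le_iff del: upt_Suc)
  also have "\<dots> \<longleftrightarrow> (\<forall>I\<subseteq>{1..n}. I \<noteq> {} \<longrightarrow> (\<exists>i\<in>I. a i + card I \<le> n + c))"
  proof (intro iffI allI impI)
    fix I assume count: "\<forall>h<n. h < card (L (h + c))" and I: "I \<subseteq> {1..n}" "I \<noteq> {}"
    then have fI: "finite I" using finite_subset by blast
    have card: "0 < card I" "card I \<le> n"
      using I fI card_mono[of "{1..n}" I] by (auto simp: card_gt_0_iff)
    show "\<exists>i\<in>I. a i + card I \<le> n + c"
    proof (rule ccontr)
      assume no: "\<not> ?thesis"
      have "L (n - card I + c) \<subseteq> {1..n} - I"
        using no card by (force simp: L_def)
      then have "card (L (n - card I + c)) \<le> card ({1..n} - I)"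
        by (intro card_mono) auto
      also have "\<dots> = n - card I"
        using I fI by (simp add: card_Diff_subset)
      finally show False
        using count card by (meson diff_less leD less_le_trans)
    qed
  next
    fix h assume cut: "\<forall>I\<subseteq>{1..n}. I \<noteq> {} \<longrightarrow> (\<exists>i\<in>I. a i + card I \<le> n + c)" and h: "h < n"
    show "h < card (L (h + c))"
    proof (rule ccontr)
      assume no: "\<not> ?thesis"
      have L: "L (h + c) \<subseteq> {1..n}" by (auto simp: L_def)
      define I where "I = {1..n} - L (h + c)"
      have card: "card I = n - card (L (h + c))"
        unfolding I_def using L by (simp add: card_Diff_subset finite_subset)
      then have "0 < card I"
        using no h by simp
      then have "I \<noteq> {}" by auto
      moreover have "I \<subseteq> {1..n}" by (auto simp: I_def)
      ultimately obtain i where "i \<in> I" "a i + card I \<le> n + c"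
        using cut by blast
      then show False
        using card no h by (auto simp: I_def L_def)
    qed
  qed
  finally show ?thesis .
qed

lemma park_exp_iff_sort:
  "e \<in> park_exp n \<longleftrightarrow> keys e \<subseteq> {1..n} \<and> (\<forall>h<n. sort (map (lookup e) [1..<n + 1]) ! h \<le> h)"
  using sort_nth_le_iff_cut[of n "lookup e" 0] by (simp add: park_exp_def)

lemma parking_function_iff_cut:
  "parking_function n a \<longleftrightarrow>
     (\<forall>i. i \<notin> {1..n} \<longrightarrow> a i = 0) \<and> (\<forall>i\<in>{1..n}. 1 \<le> a i) \<and>
     (\<forall>I\<subseteq>{1..n}. I \<noteq> {} \<longrightarrow> (\<exists>i\<in>I. a i + card I \<le> n + 1))"
proof -
  have "(\<forall>i\<in>{1..n}. sort (map a [1..<n + 1]) ! (i - 1) \<le> i) \<longleftrightarrow>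
      (\<forall>h<n. sort (map a [1..<n + 1]) ! h \<le> h + 1)"
  proof (intro iffI allI ballI impI)
    fix h assume "\<forall>i\<in>{1..n}. sort (map a [1..<n + 1]) ! (i - 1) \<le> i" "h < n"
    then show "sort (map a [1..<n + 1]) ! h \<le> h + 1"
      by (auto dest!: bspec[of _ _ "h + 1"])
  next
    fix i assume "\<forall>h<n. sort (map a [1..<n + 1]) ! h \<le> h + 1" "i \<in> {1..n}"
    then show "sort (map a [1..<n + 1]) ! (i - 1) \<le> i"
      by (auto dest!: spec[of _ "i - 1"])
  qed
  then show ?thesis
    unfolding parking_function_def sort_nth_le_iff_cut[of n a 1] by blast
qed

lemma parking_function_permute:
  assumes w: "w permutes {1..n}" and a: "parking_function n a"
  shows "parking_function n (a \<circ> w)"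
  unfolding parking_function_iff_cut
proof (intro conjI allI ballI impI)
  show "(a \<circ> w) i = 0" if "i \<notin> {1..n}" for i
    using that a permutes_in_image[OF w] unfolding parking_function_iff_cut comp_def by blast
  show "1 \<le> (a \<circ> w) i" if "i \<in> {1..n}" for i
    using that a permutes_in_image[OF w] unfolding parking_function_iff_cut comp_def by blast
  fix I assume I: "I \<subseteq> {1..n}" "I \<noteq> {}"
  have "w ` I \<subseteq> {1..n}" "w ` I \<noteq> {}"
    using I permutes_in_image[OF w] by auto
  moreover have "card (w ` I) = card I"
    using permutes_inj[OF w] by (intro card_image) (auto intro: inj_on_subset)
  ultimately show "\<exists>i\<in>I. (a \<circ> w) i + card I \<le> n + 1"
    using a unfolding parking_function_iff_cut by (metis (no_types, lifting) comp_apply imageE)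
qed

lemma parking_function_permute_iff:
  assumes "w permutes {1..n}"
  shows "parking_function n (a \<circ> w) \<longleftrightarrow> parking_function n a"
proof
  assume "parking_function n (a \<circ> w)"
  then have "parking_function n (a \<circ> w \<circ> inv' w)"
    by (rule parking_function_permute[OF permutes_inv[OF assms]])
  moreover have "a \<circ> w \<circ> inv' w = a"
    unfolding comp_assoc permutes_inv_o(1)[OF assms] by simp
  ultimately show "parking_function n a"
    by (simp only:)
qed (intro parking_function_permute assms)

text \<open>Parking functions start at 1, exponents at 0. The truncated subtraction loses nothing on
  the values of a parking function at {1..n}, and elsewhere \<open>exp_of\<close> supplies
  0.\<close>

definition park_shift :: "nat \<Rightarrow> (nat \<Rightarrow> nat) \<Rightarrow> (nat \<Rightarrow>\<^sub>0 nat)" where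
  "park_shift n a = exp_of n (\<lambda>i. a i - 1)"

lemma bij_betw_park_shift: "bij_betw (park_shift n) {a. parking_function n a} (park_exp n)"
proof (rule bij_betw_byWitness[where f' = "\<lambda>e i. if i \<in> {1..n} then lookup e i + 1 else 0"])
  show "\<forall>a\<in>{a. parking_function n a}. (\<lambda>i. if i \<in> {1..n} then lookup (park_shift n a) i + 1 else 0) = a"
  proof (intro ballI ext)
    fix a i assume "a \<in> {a. parking_function n a}"
    then have "i \<notin> {1..n} \<longrightarrow> a i = 0" "i \<in> {1..n} \<longrightarrow> 1 \<le> a i"
      unfolding parking_function_def by blast+
    then show "(if i \<in> {1..n} then lookup (park_shift n a) i + 1 else 0) = a i"
      unfolding park_shift_def lookup_exp_of by auto
  qed
  show "\<forall>e\<in>park_exp n. park_shift n (\<lambda>i. if i \<in> {1..n} then lookup e i + 1 else 0) = e"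
  proof
    fix e assume "e \<in> park_exp n"
    then have keys: "keys e \<subseteq> {1..n}"
      unfolding park_exp_def by blast
    show "park_shift n (\<lambda>i. if i \<in> {1..n} then lookup e i + 1 else 0) = e"
    proof (rule poly_mapping_eqI)
      fix i
      have "lookup e i = 0" if "i \<notin> {1..n}"
        using keys that by (auto simp flip: not_in_keys_iff_lookup_eq_zero)
      then show "lookup (park_shift n (\<lambda>i. if i \<in> {1..n} then lookup e i + 1 else 0)) i = lookup e i"
        unfolding park_shift_def lookup_exp_of by auto
    qed
  qed
  show "park_shift n ` {a. parking_function n a} \<subseteq> park_exp n"
  proof clarify
    fix a assume a: "parking_function n a"
    have "\<exists>i\<in>I. lookup (park_shift n a) i + card I \<le> n" if I: "I \<subseteq> {1..n}" "I \<noteq> {}" for I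
    proof -
      obtain i where i: "i \<in> I" "a i + card I \<le> n + 1"
        using a I unfolding parking_function_iff_cut by blast
      moreover have "1 \<le> a i"
        using a i I unfolding parking_function_iff_cut by blast
      moreover have "i \<in> {1..n}" using i I by blast
      ultimately show ?thesis
        unfolding park_shift_def lookup_exp_of by (intro bexI[of _ i]) auto
    qed
    moreover have "keys (park_shift n a) \<subseteq> {1..n}"
      by (auto simp: park_shift_def in_keys_iff split: if_splits)
    ultimately show "park_shift n a \<in> park_exp n"
      unfolding park_exp_def by blast
  qed
  show "(\<lambda>e i. if i \<in> {1..n} then lookup e i + 1 else 0) ` park_exp n \<subseteq> {a. parking_function n a}"
  proof clarify
    fix e assume e: "e \<in> park_exp n"
    have "\<exists>i\<in>I. (if i \<in> {1..n} then lookup e i + 1 else 0) + card I \<le> n + 1"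
      if I: "I \<subseteq> {1..n}" "I \<noteq> {}" for I
    proof -
      obtain i where "i \<in> I" "lookup e i + card I \<le> n"
        using e I unfolding park_exp_def by blast
      then show ?thesis by (intro bexI[of _ i]) auto
    qed
    then show "parking_function n (\<lambda>i. if i \<in> {1..n} then lookup e i + 1 else 0)"
      unfolding parking_function_iff_cut by auto
  qed
qed

text \<open>Precomposition with permutations is a right action; the inverse in
  \<open>park_rep\<close> makes it a left action, and on coefficients the inverse disappears
  again.\<close>

lemma lookup_push_permute_seq:
  assumes "bij w"
  shows "lookup (push (permute_seq (inv' w)) f) a = lookup f (a \<circ> w)"
proof -
  have 1: "permute_seq w (permute_seq (inv' w) a) = a" for a
    using assms by (simp add: permute_seq_def bij_is_inj)
  have 2: "permute_seq (inv' w) (permute_seq w a) = a" for a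
    using assms by (simp add: permute_seq_def bij_is_surj surj_f_inv_f)
  have "bij (permute_seq (inv' w))"
    using 1 2 by (metis bijI')
  moreover have "inv' (permute_seq (inv' w)) = permute_seq w"
    by (rule inv_equality) (fact 1 2)+
  ultimately show ?thesis
    by (simp add: lookup_push_bij permute_seq_def comp_def)
qed

lemma is_rep_park_rep: "is_rep (park_rep n)"
proof -
  define V where "V = {f :: (nat \<Rightarrow> nat) \<Rightarrow>\<^sub>0 complex. \<forall>a\<in>keys f. parking_function n a}"
  define r where "r = (\<lambda>w. push (permute_seq (inv\<^bsub>sym_group n\<^esub> w)) :: ((nat \<Rightarrow> nat) \<Rightarrow>\<^sub>0 complex) \<Rightarrow> _)"
  have V: "f \<in> V \<longleftrightarrow> (\<forall>a. \<not> parking_function n a \<longrightarrow> lookup f a = 0)" for f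
    by (auto simp: V_def in_keys_iff)
  have r: "lookup (r w f) a = lookup f (a \<circ> w)" if "w permutes {1..n}" for w f a
    using that by (simp add: r_def sym_group_inv_equality sym_group_carrier permutes_bij lookup_push_permute_seq)
  have "is_rep \<lparr>rgroup = sym_group n, rspace = V, ract = r\<rparr>"
    unfolding is_rep_def
  proof (simp only: rep.simps sym_group_one sym_group_mult, intro conjI ballI allI)
    show "group (sym_group n)" by (rule sym_group_is_group)
    show "cvec.subspace V"
      by (auto simp: cvec.subspace_def V lookup_add)
  next
    fix w assume "w \<in> carrier (sym_group n)"
    then have w: "w permutes {1..n}" by (simp add: sym_group_carrier)
    show "r w ` V \<subseteq> V"
      using parking_function_permute_iff[OF w] by (auto simp: V r[OF w])
    show "r w (f + g) = r w f + r w g" for f g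
      by (rule poly_mapping_eqI) (simp add: r[OF w] lookup_add)
    show "r w (c *\<^sub>C f) = c *\<^sub>C r w f" for c f
      by (rule poly_mapping_eqI) (simp add: r[OF w])
  next
    show "r id f = f" for f
      by (rule poly_mapping_eqI) (simp add: r permutes_id)
  next
    fix v w f assume "v \<in> carrier (sym_group n)" "w \<in> carrier (sym_group n)"
    then show "r (v \<circ> w) f = r v (r w f)"
      by (intro poly_mapping_eqI) (simp add: r sym_group_carrier permutes_compose comp_assoc)
  qed
  then show ?thesis
    by (simp add: park_rep_def V_def r_def)
qed

text \<open>\<phi> reads off the coefficients at shifted parking functions. It is injective by
  \<open>slim_space_eq_0\<close>, surjective by \<open>slim_space_interpolate\<close>, and
  equivariant because w acts on both kinds of indices by precomposition.\<close>

lemma slim_rep_iso_park_rep: "res_rep (carrier (sym_group n)) (slim_rep n) \<cong>\<^sub>r park_rep n"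
proof -
  define \<phi> where "\<phi> = (\<lambda>f :: cpoly. Abs_poly_mapping
    (\<lambda>a. if parking_function n a then lookup f (park_shift n a) else 0))"
  have \<phi>: "lookup (\<phi> f) a = (if parking_function n a then lookup f (park_shift n a) else 0)" for f a
  proof -
    \<comment> \<open>The support is finite because \<open>park_shift\<close> embeds it into
      \<open>keys f\<close>.\<close>
    define A where "A = {a. (if parking_function n a then lookup f (park_shift n a) else 0) \<noteq> 0}"
    have "park_shift n ` A \<subseteq> keys f"
      by (auto simp: A_def in_keys_iff split: if_splits)
    then have "finite (park_shift n ` A)"
      by (rule finite_subset) simp
    moreover have "inj_on (park_shift n) A"
      by (rule inj_on_subset[OF bij_betw_imp_inj_on[OF bij_betw_park_shift]])
        (auto simp: A_def split: if_splits)
    ultimately have "finite A"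
      by (rule finite_imageD)
    then show ?thesis
      unfolding \<phi>_def A_def by simp
  qed
  define P where "P = {f :: (nat \<Rightarrow> nat) \<Rightarrow>\<^sub>0 complex. \<forall>a\<in>keys f. parking_function n a}"
  have add: "\<phi> (f + g) = \<phi> f + \<phi> g" for f g
    by (rule poly_mapping_eqI) (simp add: \<phi> lookup_add)
  have scale: "\<phi> (c *\<^sub>C f) = c *\<^sub>C \<phi> f" for c f
    by (rule poly_mapping_eqI) (simp add: \<phi>)
  have equivariant: "\<phi> (permute_vars w f) = push (permute_seq (inv\<^bsub>sym_group n\<^esub> w)) (\<phi> f)"
    if w: "w permutes {1..n}" for w f
  proof (rule poly_mapping_eqI)
    fix a
    have "push (inv' w) (park_shift n a) = park_shift n (a \<circ> w)"
      unfolding park_shift_def push_inv_exp_of[OF w] by (simp add: comp_def)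
    then show "lookup (\<phi> (permute_vars w f)) a = lookup (push (permute_seq (inv\<^bsub>sym_group n\<^esub> w)) (\<phi> f)) a"
      using w by (simp add: \<phi> lookup_permute_vars permutes_bij sym_group_inv_equality sym_group_carrier
          lookup_push_permute_seq parking_function_permute_iff)
  qed
  have "bij_betw \<phi> (slim_space n) P"
  proof (rule bij_betwI')
    fix f g assume fg: "f \<in> slim_space n" "g \<in> slim_space n"
    show "\<phi> f = \<phi> g \<longleftrightarrow> f = g"
    proof
      assume eq: "\<phi> f = \<phi> g"
      have "lookup (f - g) e = 0" if "e \<in> park_exp n" for e
      proof -
        have "e \<in> park_shift n ` {a. parking_function n a}"
          using that by (simp only: bij_betw_imp_surj_on[OF bij_betw_park_shift])
        then obtain a where a: "parking_function n a" "e = park_shift n a"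
          by blast
        then show ?thesis
          using arg_cong[OF eq, of "\<lambda>p. lookup p a"] by (simp add: \<phi> lookup_minus)
      qed
      moreover have "f - g \<in> slim_space n"
        using fg subspace_slim_space cvec.subspace_diff by blast
      ultimately have "f - g = 0"
        by (intro slim_space_eq_0) auto
      then show "f = g" by simp
    qed simp
  next
    show "\<phi> f \<in> P" for f
      by (auto simp: P_def in_keys_iff \<phi> split: if_splits)
  next
    fix F assume F: "F \<in> P"
    obtain f where f: "f \<in> slim_space n"
      "\<forall>e\<in>park_exp n. lookup f e = lookup F (inv_into {a. parking_function n a} (park_shift n) e)"
      using slim_space_interpolate[of n
          "\<lambda>e. lookup F (inv_into {a. parking_function n a} (park_shift n) e)"] by blast
    have "F = \<phi> f"
    proof (rule poly_mapping_eqI)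
      fix a
      show "lookup F a = lookup (\<phi> f) a"
      proof (cases "parking_function n a")
        case True
        then have "inv_into {a. parking_function n a} (park_shift n) (park_shift n a) = a"
          by (intro inv_into_f_f bij_betw_imp_inj_on[OF bij_betw_park_shift]) simp
        moreover have "park_shift n a \<in> park_exp n"
          using True bij_betw_apply[OF bij_betw_park_shift] by blast
        ultimately show ?thesis
          using True f by (simp add: \<phi>)
      next
        case False
        then have "a \<notin> keys F"
          using F unfolding P_def by blast
        then show ?thesis
          using False by (simp add: \<phi> in_keys_iff)
      qed
    qed
    then show "\<exists>f\<in>slim_space n. F = \<phi> f"
      using f by blast
  qed
  moreover have "is_rep \<lparr>rgroup = sym_group n, rspace = slim_space n, ract = permute_vars\<rparr>"
    by (intro permute_vars_is_rep subspace_slim_space permute_vars_slim_space permutes_Suc)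
  moreover have park: "park_rep n = \<lparr>rgroup = sym_group n, rspace = P,
      ract = (\<lambda>w. push (permute_seq (inv\<^bsub>sym_group n\<^esub> w)))\<rparr>"
    by (simp add: park_rep_def P_def)
  ultimately show ?thesis
    using is_rep_park_rep[of n] unfolding slim_rep_def res_sym_group park
    by (intro rep_isoI[where \<phi> = \<phi>]) (simp_all only: rep.simps add scale equivariant sym_group_carrier)
qed

section \<open>Dyck paths and Young subgroups\<close>

text \<open>\<open>columns 0 D\<close> lists the \<open>x\<close>-coordinates of the vertical steps of \<open>D\<close>; it is the area partition
  read from bottom to top.\<close>
fun columns :: "nat \<Rightarrow> step list \<Rightarrow> nat list" where
  "columns c [] = []"
| "columns c (Vert # D) = c # columns c D"
| "columns c (Horiz # D) = columns (Suc c) D"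

text \<open>Inverse of \<open>columns\<close>: the path starts at x-coordinate c, walks right to
  each listed column and ends at N.\<close>

fun path_of :: "nat \<Rightarrow> nat \<Rightarrow> nat list \<Rightarrow> step list" where
  "path_of N c [] = replicate (N - c) Horiz"
| "path_of N c (v # b) = replicate (v - c) Horiz @ Vert # path_of N v b"

section \<open>Dyck paths as sorted column lists\<close>

lemma length_columns: "length (columns c D) = count_list D Vert"
  by (induction c D rule: columns.induct) auto

lemma columns_ge: "v \<in> set (columns c D) \<Longrightarrow> c \<le> v"
  by (induction c D rule: columns.induct) auto

lemma sorted_columns: "sorted (columns c D)"
  by (induction c D rule: columns.induct) (auto dest: columns_ge)

lemma path_of_Suc:
  assumes "Suc c \<le> N" "\<forall>v\<in>set b. Suc c \<le> v"
  shows "path_of N c b = Horiz # path_of N (Suc c) b"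
  using assms by (cases b) (auto simp: Suc_diff_le[symmetric] simp flip: replicate_Suc)

lemma path_of_columns: "path_of (c + count_list D Horiz) c (columns c D) = D"
proof (induction c D rule: columns.induct)
  case (3 c D)
  have "path_of (c + count_list (Horiz # D) Horiz) c (columns (Suc c) D) =
      Horiz # path_of (c + count_list (Horiz # D) Horiz) (Suc c) (columns (Suc c) D)"
    by (rule path_of_Suc) (auto dest: columns_ge)
  then show ?case using 3 by simp
qed auto

lemma columns_replicate_Horiz: "columns c (replicate k Horiz @ D) = columns (c + k) D"
  by (induction k arbitrary: c) auto

lemma columns_path_of: "sorted (c # b) \<Longrightarrow> columns c (path_of N c b) = b"
proof (induction b arbitrary: c)
  case Nil
  then show ?case
    using columns_replicate_Horiz[of c "N - c" "[]"] by simp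
qed (auto simp: columns_replicate_Horiz)

lemma count_list_replicate: "count_list (replicate k x) y = (if x = y then k else 0)"
  by (induction k) auto

lemma count_path_of:
  assumes "sorted (c # b)" "\<forall>v\<in>set b. v \<le> N" "c \<le> N"
  shows "count_list (path_of N c b) Horiz = N - c" "count_list (path_of N c b) Vert = length b"
  using assms by (induction b arbitrary: c) (auto simp: count_list_replicate count_list_append)

text \<open>Only horizontal steps approach the diagonal, so it is enough to check the points before
  vertical steps and the end. The general start (c, d) is for the induction.\<close>

lemma prefix_condition_iff_columns:
  "(\<forall>i\<le>length D. c + count_list (take i D) Horiz \<le> d + count_list (take i D) Vert) \<longleftrightarrow>
     (\<forall>h<length (columns c D). columns c D ! h \<le> d + h) \<and>
     c + count_list D Horiz \<le> d + count_list D Vert"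
proof (induction c D arbitrary: d rule: columns.induct)
  case (1 c)
  then show ?case by simp
next
  case (2 c D)
  then show ?case
    using "2.IH"[of "Suc d"] by (simp add: All_less_Suc2 flip: less_Suc_eq_le)
next
  case (3 c D)
  have "c \<le> d" if "\<forall>i<Suc (length D). Suc c + count_list (take i D) Horiz \<le> d + count_list (take i D) Vert"
    using that by (auto dest: spec[of _ 0])
  then show ?case
    using "3.IH"[of d] by (simp add: All_less_Suc2 flip: less_Suc_eq_le) auto
qed

lemma dyck_path_iff_columns:
  "dyck_path n D \<longleftrightarrow> count_list D Horiz = n \<and> count_list D Vert = n \<and> (\<forall>h<n. columns 0 D ! h \<le> h)"
  using prefix_condition_iff_columns[of D 0 0]
  by (auto simp: dyck_path_def endpoint_def length_columns)

lemma vertical_step_iff_columns: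
  "(\<exists>i<length D. D ! i = Vert \<and> x < c + count_list (take i D) Horiz \<and> h = d + count_list (take i D) Vert)
     \<longleftrightarrow> d \<le> h \<and> h - d < length (columns c D) \<and> x < columns c D ! (h - d)"
proof (induction c D arbitrary: d rule: columns.induct)
  case (2 c D)
  have "h - d = Suc (h - Suc d)" if "Suc d \<le> h" using that by simp
  then show ?case
    using "2.IH"[of "Suc d"] by (cases "h = d") (auto simp: Ex_less_Suc2)
next
  case (3 c D)
  then show ?case
    using "3.IH"[of d] by (simp add: Ex_less_Suc2)
qed simp

lemma upper_left_boxes_iff_columns:
  "(x, h) \<in> upper_left_boxes D \<longleftrightarrow> h < length (columns 0 D) \<and> x < columns 0 D ! h"
  using vertical_step_iff_columns[of D x 0 h 0] by (simp add: upper_left_boxes_def endpoint_def)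

lemma area_eq_sum_columns:
  assumes "dyck_path n D"
  shows "area n D = sum_list (columns 0 D)"
proof -
  have len: "length (columns 0 D) = n"
    using assms by (simp add: dyck_path_iff_columns length_columns)
  have "card {x. (x, n - 1 - r) \<in> upper_left_boxes D} = columns 0 D ! (n - Suc r)" if "r < n" for r
    using that by (simp add: upper_left_boxes_iff_columns len)
  \<comment> \<open>The area partition lists rows from the top, \<open>columns\<close> from the
    bottom; the sum is reversed accordingly.\<close>
  then have "area n D = (\<Sum>r<n. columns 0 D ! (n - Suc r))"
    by (simp add: area_def area_partition_def interv_sum_list_conv_sum_set_nat lessThan_atLeast0)
  also have "\<dots> = (\<Sum>h<n. columns 0 D ! h)"
    by (rule sum.nat_diff_reindex)
  also have "\<dots> = sum_list (columns 0 D)"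
    by (simp add: sum_list_sum_nth len lessThan_atLeast0)
  finally show ?thesis .
qed

section \<open>Vertical runs as fibres of the column list\<close>

lemma columns_conv_filter:
  "columns c D = map (\<lambda>l. c + count_list (take l D) Horiz) (filter (\<lambda>l. D ! l = Vert) [0..<length D])"
proof -
  have upt: "[0..<Suc k] = 0 # map Suc [0..<k]" for k
    using upt_conv_Cons[of 0 "Suc k"] by (simp add: map_Suc_upt del: upt_Suc)
  show ?thesis
    by (induction c D rule: columns.induct) (simp_all add: upt filter_map comp_def del: upt_Suc)
qed

text \<open>The positions of the vertical steps on the line x = v. If there are any, they turn out
  to form a single vertical run.\<close>

definition column_steps :: "step list \<Rightarrow> nat \<Rightarrow> nat set" where
  "column_steps D v = {l. l < length D \<and> D ! l = Vert \<and> count_list (take l D) Horiz = v}"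

lemma count_columns: "count (mset (columns 0 D)) v = card (column_steps D v)"
proof -
  have "count (mset (columns 0 D)) v =
      length (filter (\<lambda>l. count_list (take l D) Horiz = v) (filter (\<lambda>l. D ! l = Vert) [0..<length D]))"
    unfolding columns_conv_filter count_mset count_list_eq_length_filter filter_map length_map
    by (simp add: comp_def eq_commute[of v])
  also have "\<dots> = card (set (filter (\<lambda>l. count_list (take l D) Horiz = v)
      (filter (\<lambda>l. D ! l = Vert) [0..<length D])))"
    by (rule distinct_card[symmetric]) simp
  also have "set (filter (\<lambda>l. count_list (take l D) Horiz = v)
      (filter (\<lambda>l. D ! l = Vert) [0..<length D])) = column_steps D v"
    by (auto simp: column_steps_def)
  finally show ?thesis .
qed

lemma set_columns: "v \<in> set (columns 0 D) \<longleftrightarrow> column_steps D v \<noteq> {}"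
  by (auto simp: columns_conv_filter column_steps_def image_iff)

lemma finite_column_steps [simp]: "finite (column_steps D v)"
  by (rule finite_subset[of _ "{..<length D}"]) (auto simp: column_steps_def)

lemma count_take_Suc:
  "l < length D \<Longrightarrow> count_list (take (Suc l) D) x = count_list (take l D) x + (if D ! l = x then 1 else 0)"
  by (simp add: take_Suc_conv_app_nth count_list_append)

lemma count_take_mono: "l \<le> l' \<Longrightarrow> count_list (take l D) x \<le> count_list (take l' D) x"
  by (metis count_list_append le_add1 le_add_diff_inverse take_add)

text \<open>No horizontal step occurs inside a run, while any horizontal step bounding it changes
  the x-coordinate, so the run fills its column.\<close>

lemma vertical_run_column:
  assumes "(i, j) \<in> vertical_runs D"
  shows "column_steps D (count_list (take i D) Horiz) = {i..<j}"
proof -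
  let ?hc = "\<lambda>l. count_list (take l D) Horiz"
  have ij: "i < j" "j \<le> length D" and V: "\<forall>l\<in>{i..<j}. D ! l = Vert"
    and left: "i = 0 \<or> D ! (i - 1) = Horiz" and right: "j = length D \<or> D ! j = Horiz"
    using assms by (auto simp: vertical_runs_def)
  have const: "?hc l = ?hc i" if "i \<le> l" "l \<le> j" for l
    using that
  proof (induction l rule: dec_induct)
    case (step l)
    then show ?case using ij V by (simp add: count_take_Suc)
  qed simp
  show ?thesis
  proof (intro equalityI subsetI)
    fix l assume "l \<in> column_steps D (?hc i)"
    then have l: "l < length D" "D ! l = Vert" "?hc l = ?hc i"
      by (auto simp: column_steps_def)
    have "i \<le> l"
    proof (rule ccontr)
      assume "\<not> i \<le> l"
      then have "l \<le> i - 1" "0 < i" by auto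
      then have "?hc l \<le> ?hc (i - 1)" "?hc i = ?hc (i - 1) + 1"
        using left ij count_take_Suc[of "i - 1" D Horiz] count_take_mono by auto
      then show False using l by simp
    qed
    moreover have "l < j"
    proof (rule ccontr)
      assume "\<not> l < j"
      then have j: "j < length D" "D ! j = Horiz"
        using l right by auto
      then have "l \<noteq> j" using l by auto
      then have "?hc (Suc j) \<le> ?hc l"
        using \<open>\<not> l < j\<close> by (intro count_take_mono) auto
      then show False
        using l j const[of j] ij by (simp add: count_take_Suc)
    qed
    ultimately show "l \<in> {i..<j}" by simp
  next
    fix l assume "l \<in> {i..<j}"
    then show "l \<in> column_steps D (?hc i)"
      using V ij const[of l] by (auto simp: column_steps_def)
  qed
qed

text \<open>The run reaches from the first to the last step in the column: a horizontal step in
  between would raise the x-coordinate for good.\<close>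

lemma vertical_run_of_column:
  assumes "v \<in> set (columns 0 D)"
  obtains i j where "(i, j) \<in> vertical_runs D" "count_list (take i D) Horiz = v"
proof -
  let ?hc = "\<lambda>l. count_list (take l D) Horiz"
  define L where "L = column_steps D v"
  have L: "finite L" "L \<noteq> {}"
    using assms by (auto simp: L_def set_columns)
  define i where "i = Min L"
  define k where "k = Max L"
  have "i \<in> L" "k \<in> L" and le: "i \<le> k"
    using L by (auto simp: i_def k_def)
  then have i: "i < length D" "D ! i = Vert" "?hc i = v" and k: "k < length D" "D ! k = Vert" "?hc k = v"
    by (auto simp: L_def column_steps_def)
  have V: "D ! l = Vert" if l: "i \<le> l" "l \<le> k" for l
  proof (rule ccontr)
    assume nV: "D ! l \<noteq> Vert"
    then have H: "D ! l = Horiz" by (cases "D ! l") auto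
    then have "l \<noteq> k" using k by auto
    then have "?hc (Suc l) \<le> ?hc k"
      using l by (intro count_take_mono) auto
    moreover have "?hc i \<le> ?hc l"
      using l by (intro count_take_mono)
    ultimately show False
      using H l k i by (simp add: count_take_Suc)
  qed
  have "i = 0 \<or> D ! (i - 1) = Horiz"
  proof (rule ccontr)
    assume "\<not> ?thesis"
    then have "0 < i" "D ! (i - 1) = Vert" by (cases "D ! (i - 1)"; auto)+
    then have "i - 1 \<in> L"
      using i count_take_Suc[of "i - 1" D Horiz] by (auto simp: L_def column_steps_def)
    then have "i \<le> i - 1"
      using L unfolding i_def by (intro Min_le)
    then show False using \<open>0 < i\<close> by simp
  qed
  moreover have "Suc k = length D \<or> D ! Suc k = Horiz"
  proof (rule ccontr)
    assume "\<not> ?thesis"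
    then have "Suc k < length D" "D ! Suc k = Vert"
      using k by (cases "D ! Suc k"; auto)+
    then have "Suc k \<in> L"
      using k by (auto simp: L_def column_steps_def count_take_Suc)
    then have "Suc k \<le> k"
      using L unfolding k_def by (intro Max_ge)
    then show False by simp
  qed
  ultimately have "(i, Suc k) \<in> vertical_runs D"
    using V le k by (auto simp: vertical_runs_def)
  then show ?thesis
    using that i by blast
qed

text \<open>Runs correspond to the distinct columns through their x-coordinate, and the length of a
  run is the multiplicity of that value in the column list.\<close>

lemma run_partition_eq_columns:
  "run_partition D = rev (sorted_list_of_multiset
     (image_mset (count (mset (columns 0 D))) (mset_set (set (columns 0 D)))))"
proof -
  let ?col = "\<lambda>(i, j :: nat). count_list (take i D) Horiz"
  have inj: "inj_on ?col (vertical_runs D)"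
  proof (rule inj_onI, clarify)
    fix i j i' j' assume runs: "(i, j) \<in> vertical_runs D" "(i', j') \<in> vertical_runs D"
      and "count_list (take i D) Horiz = count_list (take i' D) Horiz"
    then have "{i..<j} = {i'..<j'}"
      using vertical_run_column by metis
    then show "i = i' \<and> j = j'"
      using runs by (auto simp: vertical_runs_def dest: atLeastLessThan_inj)
  qed
  have img: "?col ` vertical_runs D = set (columns 0 D)"
  proof (intro equalityI subsetI)
    fix v assume "v \<in> ?col ` vertical_runs D"
    then obtain i j where "(i, j) \<in> vertical_runs D" "v = count_list (take i D) Horiz" by auto
    then show "v \<in> set (columns 0 D)"
      using vertical_run_column[of i j D] by (auto simp: set_columns vertical_runs_def)
  next
    fix v assume "v \<in> set (columns 0 D)"
    then show "v \<in> ?col ` vertical_runs D"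
      by (rule vertical_run_of_column) force
  qed
  have fin: "finite (vertical_runs D)"
    using inj img by (metis List.finite_set finite_imageD)
  have "{# j - i. (i, j) \<in># mset_set (vertical_runs D) #} =
      image_mset (\<lambda>p. count (mset (columns 0 D)) (?col p)) (mset_set (vertical_runs D))"
    by (rule image_mset_cong) (use fin vertical_run_column in \<open>auto simp: count_columns\<close>)
  also have "\<dots> = image_mset (count (mset (columns 0 D))) (image_mset ?col (mset_set (vertical_runs D)))"
    by (simp add: multiset.map_comp comp_def)
  also have "image_mset ?col (mset_set (vertical_runs D)) = mset_set (set (columns 0 D))"
    using image_mset_mset_set[OF inj] img by simp
  finally show ?thesis
    by (simp add: run_partition_def)
qed

section \<open>Young blocks and stabilisers of fillings\<close>

lemma young_block_Cons:
  "young_block (c # lam) 0 = {1..c}"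
  "young_block (c # lam) (Suc k) = (+) c ` young_block lam k"
  by (auto simp: young_block_def image_add_atLeastAtMost add_ac)

text \<open>For distinct vs, the Young blocks of \<open>map f vs\<close> are the positions, counted
  from 1, of the constant stretches of this list.\<close>

definition block_list :: "('a \<Rightarrow> nat) \<Rightarrow> 'a list \<Rightarrow> 'a list" where
  "block_list f vs = concat (map (\<lambda>v. replicate (f v) v) vs)"

lemma block_list_Cons: "block_list f (v # vs) = replicate (f v) v @ block_list f vs"
  by (simp add: block_list_def)

lemma young_block_nth:
  assumes "k < length vs" "i \<in> young_block (map f vs) k"
  shows "i \<in> {1..length (block_list f vs)} \<and> block_list f vs ! (i - 1) = vs ! k"
  using assms
proof (induction vs arbitrary: i k)
  case (Cons v vs)
  show ?case
  proof (cases k)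
    case 0
    then show ?thesis
      using Cons.prems by (auto simp: young_block_Cons block_list_Cons nth_append)
  next
    case (Suc k')
    then obtain i' where i': "i = f v + i'" "i' \<in> young_block (map f vs) k'"
      using Cons.prems by (auto simp: young_block_Cons)
    then have "i' \<in> {1..length (block_list f vs)} \<and> block_list f vs ! (i' - 1) = vs ! k'"
      using Cons Suc by auto
    then show ?thesis
      using i' Suc by (auto simp: block_list_Cons nth_append)
  qed
qed simp

lemma young_block_cover:
  assumes "i \<in> {1..length (block_list f vs)}"
  shows "\<exists>k<length vs. i \<in> young_block (map f vs) k"
  using assms
proof (induction vs arbitrary: i)
  case Nil
  then show ?case by (simp add: block_list_def)
next
  case (Cons v vs)
  show ?case
  proof (cases "i \<le> f v")
    case True
    then show ?thesis
      using Cons.prems by (intro exI[of _ 0]) (auto simp: young_block_Cons)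
  next
    case False
    then have "i - f v \<in> {1..length (block_list f vs)}"
      using Cons.prems by (auto simp: block_list_Cons)
    then obtain k where "k < length vs" "i - f v \<in> young_block (map f vs) k"
      using Cons.IH by blast
    then show ?thesis
      using False by (intro exI[of _ "Suc k"]) (auto simp: young_block_Cons intro!: image_eqI[of _ _ "i - f v"])
  qed
qed

lemma count_block_list:
  "distinct vs \<Longrightarrow> count (mset (block_list f vs)) u = (if u \<in> set vs then f u else 0)"
  by (induction vs) (auto simp: block_list_def)

text \<open>Sorting the distinct values by f shows which value belongs to which part of the
  partition, so that the parts can be read as sizes of blocks labelled by values.\<close>

lemma sorted_multiset_conv_map:
  fixes f :: "'a \<Rightarrow> 'b::linorder"
  obtains vs where "distinct vs" "set vs = set b"
    "rev (sorted_list_of_multiset (image_mset f (mset_set (set b)))) = map f vs"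
proof
  define us where "us = sort_key f (remdups b)"
  show "distinct (rev us)" "set (rev us) = set b"
    by (auto simp: us_def)
  have "mset_set (set b) = mset us"
    using mset_set_set[of us] by (simp add: us_def)
  then have "sorted_list_of_multiset (image_mset f (mset_set (set b))) = sort (map f us)"
    by (metis mset_map sorted_list_of_multiset_mset)
  also have "\<dots> = map f us"
    by (rule sorted_sort_id) (simp add: us_def)
  finally show "rev (sorted_list_of_multiset (image_mset f (mset_set (set b)))) = map f (rev us)"
    by (simp add: rev_map)
qed

text \<open>A filling of \<open>1, \<dots>, n\<close> with the entries of \<open>b\<close> that is constant precisely on the Young blocks
  of the partition formed by the multiplicities of \<open>b\<close>.\<close>
lemma young_subgroup_stabilizer:
  fixes b :: "nat list"
  assumes "length b = n"
  obtains \<alpha> :: "nat \<Rightarrow> nat" where "mset (map \<alpha> [1..<n + 1]) = mset b"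
    "young_subgroup n (rev (sorted_list_of_multiset (image_mset (count (mset b)) (mset_set (set b))))) =
       {w. w permutes {1..n} \<and> (\<forall>i\<in>{1..n}. \<alpha> (w i) = \<alpha> i)}"
proof -
  define f where "f = count (mset b)"
  obtain vs where vs: "distinct vs" "set vs = set b"
    and lam: "rev (sorted_list_of_multiset (image_mset f (mset_set (set b)))) = map f vs"
    by (rule sorted_multiset_conv_map)
  define xs where "xs = block_list f vs"
  have "mset xs = mset b"
    using vs by (intro multiset_eqI) (auto simp: xs_def count_block_list f_def count_eq_zero_iff)
  then have len: "length xs = n"
    using assms by (metis size_mset)
  \<comment> \<open>Lists are indexed from 0, the letters of the symmetric group from 1.\<close>
  define \<alpha> where "\<alpha> = (\<lambda>i. xs ! (i - 1))"
  have "map \<alpha> [1..<n + 1] = xs"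
    by (rule nth_equalityI) (auto simp: len \<alpha>_def simp del: upt_Suc)
  then have mset: "mset (map \<alpha> [1..<n + 1]) = mset b"
    using \<open>mset xs = mset b\<close> by simp
  have block: "young_block (map f vs) k = {i \<in> {1..n}. \<alpha> i = vs ! k}" if k: "k < length vs" for k
  proof (intro equalityI subsetI)
    fix i assume "i \<in> young_block (map f vs) k"
    then show "i \<in> {i \<in> {1..n}. \<alpha> i = vs ! k}"
      using young_block_nth[OF k, of i f] len by (auto simp: \<alpha>_def xs_def)
  next
    fix i assume i: "i \<in> {i \<in> {1..n}. \<alpha> i = vs ! k}"
    then obtain k' where k': "k' < length vs" "i \<in> young_block (map f vs) k'"
      using young_block_cover[of i f vs] len by (auto simp: xs_def)
    then have "vs ! k' = vs ! k"
      using young_block_nth[OF k'] i by (auto simp: \<alpha>_def xs_def)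
    then show "i \<in> young_block (map f vs) k"
      using k k' vs(1) by (auto simp: nth_eq_iff_index_eq)
  qed
  have "young_subgroup n (map f vs) = {w. w permutes {1..n} \<and> (\<forall>i\<in>{1..n}. \<alpha> (w i) = \<alpha> i)}"
  proof (intro equalityI subsetI)
    fix w assume w: "w \<in> young_subgroup n (map f vs)"
    then have perm: "w permutes {1..n}"
      by (simp add: young_subgroup_def sym_group_carrier)
    have "\<alpha> (w i) = \<alpha> i" if "i \<in> {1..n}" for i
    proof -
      obtain k where k: "k < length vs" "i \<in> young_block (map f vs) k"
        using young_block_cover[of i f vs] len \<open>i \<in> {1..n}\<close> by (auto simp: xs_def)
      then have "w i \<in> young_block (map f vs) k"
        using w by (auto simp: young_subgroup_def)
      then show ?thesis
        using k block by auto
    qed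
    then show "w \<in> {w. w permutes {1..n} \<and> (\<forall>i\<in>{1..n}. \<alpha> (w i) = \<alpha> i)}"
      using perm by auto
  next
    fix w assume "w \<in> {w. w permutes {1..n} \<and> (\<forall>i\<in>{1..n}. \<alpha> (w i) = \<alpha> i)}"
    then have perm: "w permutes {1..n}" and stab: "\<forall>i\<in>{1..n}. \<alpha> (w i) = \<alpha> i" by auto
    have "w ` young_block (map f vs) k = young_block (map f vs) k" if k: "k < length vs" for k
    proof (rule card_subset_eq)
      show "finite (young_block (map f vs) k)"
        by (simp add: young_block_def)
      show "w ` young_block (map f vs) k \<subseteq> young_block (map f vs) k"
        unfolding block[OF k] using stab permutes_in_image[OF perm] by auto
      show "card (w ` young_block (map f vs) k) = card (young_block (map f vs) k)"
        using permutes_inj[OF perm] by (intro card_image) (auto intro: inj_on_subset)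
    qed
    then show "w \<in> young_subgroup n (map f vs)"
      using perm by (simp add: young_subgroup_def sym_group_carrier)
  qed
  then show ?thesis
    using that[of \<alpha>] mset lam by (simp add: f_def)
qed

section \<open>The Young modules\<close>

text \<open>For the trivial representation, the induced module consists of the functions on S_n
  invariant under left translation by the Young subgroup. Right translation commutes with left
  translation and so preserves them.\<close>

lemma is_rep_young_rep: "is_rep (young_rep n lam)"
proof -
  define H where "H = young_subgroup n lam"
  define V where "V = {f :: (nat \<Rightarrow> nat) \<Rightarrow> complex. (\<forall>x. \<not> x permutes {1..n} \<longrightarrow> f x = 0) \<and>
    (\<forall>h\<in>H. \<forall>x. x permutes {1..n} \<longrightarrow> f (h \<circ> x) = f x)}"
  define r where "r = (\<lambda>g (f :: (nat \<Rightarrow> nat) \<Rightarrow> complex) x. if x permutes {1..n} then f (x \<circ> g) else 0)"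
  have "is_rep \<lparr>rgroup = sym_group n, rspace = V, ract = r\<rparr>"
    unfolding is_rep_def
  proof (simp only: rep.simps sym_group_one sym_group_mult, intro conjI ballI allI)
    show "group (sym_group n)" by (rule sym_group_is_group)
    show "cvec.subspace V"
      by (auto simp: cvec.subspace_def V_def scaleC_fun_def)
  next
    fix g assume "g \<in> carrier (sym_group n)"
    then have g: "g permutes {1..n}" by (simp add: sym_group_carrier)
    show "r g ` V \<subseteq> V"
    proof
      fix f' assume "f' \<in> r g ` V"
      then obtain f where f: "f \<in> V" "f' = r g f" by blast
      have H: "h permutes {1..n}" if "h \<in> H" for h
        using that by (simp add: H_def young_subgroup_def sym_group_carrier)
      moreover have "f (h \<circ> (x \<circ> g)) = f (x \<circ> g)" if "h \<in> H" "x permutes {1..n}" for h x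
        using f(1) that permutes_compose[OF g that(2)] unfolding V_def by blast
      ultimately show "f' \<in> V"
        by (auto simp: f(2) V_def r_def permutes_compose comp_assoc simp del: One_nat_def)
    qed
    show "r g (f + f') = r g f + r g f'" for f f'
      by (auto simp: r_def)
    show "r g (c *\<^sub>C f) = c *\<^sub>C r g f" for c f
      by (auto simp: r_def scaleC_fun_def)
  next
    show "r id f = f" if "f \<in> V" for f
      using that by (auto simp: r_def V_def)
  next
    fix g h f assume "g \<in> carrier (sym_group n)" "h \<in> carrier (sym_group n)"
    then show "r (g \<circ> h) f = r g (r h f)"
      by (auto simp: r_def sym_group_carrier permutes_compose comp_assoc)
  qed
  moreover have "young_rep n lam = \<lparr>rgroup = sym_group n, rspace = V, ract = r\<rparr>"
    by (auto simp: young_rep_def ind_rep_def trivial_rep_def V_def r_def H_def sym_group_carrier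
        sym_group_mult fun_eq_iff)
  ultimately show ?thesis by simp
qed

lemma rspace_young_rep:
  "f \<in> rspace (young_rep n lam) \<longleftrightarrow> (\<forall>x. \<not> x permutes {1..n} \<longrightarrow> f x = 0) \<and>
    (\<forall>h\<in>young_subgroup n lam. \<forall>x. x permutes {1..n} \<longrightarrow> f (h \<circ> x) = f x)"
  by (auto simp: young_rep_def ind_rep_def trivial_rep_def sym_group_carrier sym_group_mult)

lemma ract_young_rep:
  "ract (young_rep n lam) g f = (\<lambda>x. if x permutes {1..n} then f (x \<circ> g) else 0)"
  by (auto simp: young_rep_def ind_rep_def sym_group_carrier sym_group_mult fun_eq_iff)

lemma rgroup_young_rep: "rgroup (young_rep n lam) = sym_group n"
  by (simp add: young_rep_def ind_rep_def)

lemma is_rep_dsum_rep: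
  assumes G: "group G" and R: "\<And>i. i \<in> I \<Longrightarrow> is_rep (R i)" "\<And>i. i \<in> I \<Longrightarrow> rgroup (R i) = G"
  shows "is_rep (dsum_rep G I R)"
proof -
  have sub: "cvec.subspace (rspace (R i))" if "i \<in> I" for i
    using R(1)[OF that] by (simp add: is_rep_def)
  have act: "ract (R i) g u \<in> rspace (R i)"
    "v \<in> rspace (R i) \<Longrightarrow> ract (R i) g (u + v) = ract (R i) g u + ract (R i) g v"
    "ract (R i) g (c *\<^sub>C u) = c *\<^sub>C ract (R i) g u" "ract (R i) \<one>\<^bsub>G\<^esub> u = u"
    "h \<in> carrier G \<Longrightarrow> ract (R i) (g \<otimes>\<^bsub>G\<^esub> h) u = ract (R i) g (ract (R i) h u)"
    if "i \<in> I" "g \<in> carrier G" "u \<in> rspace (R i)" for i g h u v c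
    using R(1)[OF that(1)] that unfolding is_rep_def R(2)[OF that(1)] by blast+
  define V where "V = rspace (dsum_rep G I R)"
  define r where "r = ract (dsum_rep G I R)"
  have V: "F \<in> V \<longleftrightarrow> (\<forall>i\<in>I. F i \<in> rspace (R i)) \<and> (\<forall>i. i \<notin> I \<longrightarrow> F i = 0)" for F
    by (simp add: V_def dsum_rep_def)
  have r: "r g F = (\<lambda>i. if i \<in> I then ract (R i) g (F i) else 0)" for g F
    by (simp add: r_def dsum_rep_def)
  have one: "\<one>\<^bsub>G\<^esub> \<in> carrier G"
    using G by (simp add: group.is_monoid monoid.one_closed)
  have "is_rep \<lparr>rgroup = G, rspace = V, ract = r\<rparr>"
    unfolding is_rep_def
  proof (simp only: rep.simps, intro conjI ballI allI)
    show "group G" by (rule G)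
    show "cvec.subspace V"
      using sub by (auto simp: cvec.subspace_def V scaleC_fun_def)
  next
    fix g assume g: "g \<in> carrier G"
    show "r g ` V \<subseteq> V"
      using act(1) g by (auto simp: V r)
    show "r g (u + v) = r g u + r g v" if "u \<in> V" "v \<in> V" for u v
      using that act(2) g by (auto simp: V r)
    show "r g (c *\<^sub>C v) = c *\<^sub>C r g v" if "v \<in> V" for c v
      using that act(3) g by (auto simp: V r scaleC_fun_def)
  next
    show "r \<one>\<^bsub>G\<^esub> v = v" if "v \<in> V" for v
      using that act(4)[OF _ one] by (auto simp: V r)
  next
    show "r (g \<otimes>\<^bsub>G\<^esub> h) v = r g (r h v)" if "g \<in> carrier G" "h \<in> carrier G" "v \<in> V" for g h v
      using that act(5) by (auto simp: V r)
  qed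
  moreover have "dsum_rep G I R = \<lparr>rgroup = G, rspace = V, ract = r\<rparr>"
    by (simp add: V_def r_def dsum_rep_def)
  ultimately show ?thesis by simp
qed

section \<open>Orbits of exponent vectors and the isomorphism in each degree\<close>

lemma mset_map_permute:
  assumes "x permutes {1..n}"
  shows "mset (map (\<alpha> \<circ> x) [1..<n + 1]) = mset (map \<alpha> [1..<n + 1])"
proof -
  have upt: "mset [1..<n + 1] = mset_set {1..n}"
    by (simp add: atLeastLessThanSuc_atLeastAtMost del: upt_Suc)
  have "mset (map (\<alpha> \<circ> x) [1..<n + 1]) = image_mset \<alpha> (image_mset x (mset_set {1..n}))"
    unfolding mset_map upt by (simp add: multiset.map_comp)
  also have "image_mset x (mset_set {1..n}) = mset_set {1..n}"
    using assms by (rule permutes_image_mset)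
  finally show ?thesis
    unfolding mset_map upt .
qed

lemma map_lookup_exp_of: "map (lookup (exp_of n g)) [1..<n + 1] = map g [1..<n + 1]"
  by (rule map_cong) (auto simp del: upt_Suc)

lemma monom_degree_exp:
  assumes "keys e \<subseteq> {1..n}"
  shows "monom_degree e = sum_list (map (lookup e) [1..<n + 1])"
proof -
  have "monom_degree e = sum (lookup e) {1..n}"
    using assms by (intro monom_degree_superset) auto
  then show ?thesis
    by (simp add: interv_sum_list_conv_sum_set_nat atLeastLessThanSuc_atLeastAtMost del: upt_Suc)
qed

lemma keys_exp_of: "keys (exp_of n g) \<subseteq> {1..n}"
  by (auto simp: in_keys_iff split: if_splits)

lemma path_of_columns_dyck:
  assumes "dyck_path n D"
  shows "path_of n 0 (columns 0 D) = D"
  using assms path_of_columns[of 0 D] by (simp add: dyck_path_iff_columns)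

lemma ex_dyck_path:
  assumes "sorted b" "length b = n" "\<forall>h<n. b ! h \<le> h"
  shows "\<exists>D. dyck_path n D \<and> columns 0 D = b"
proof -
  have "\<forall>v\<in>set b. v \<le> n"
  proof
    fix v assume "v \<in> set b"
    then obtain h where "h < n" "b ! h = v"
      using assms(2) by (auto simp: in_set_conv_nth)
    then show "v \<le> n" using assms(3) by (metis le_trans less_imp_le)
  qed
  then have "dyck_path n (path_of n 0 b) \<and> columns 0 (path_of n 0 b) = b"
    using assms count_path_of[of 0 b n] columns_path_of[of 0 b n] by (simp add: dyck_path_iff_columns)
  then show ?thesis ..
qed

text \<open>An exponent in \<open>park_exp n\<close> belongs to the Dyck path whose column list is
  its sorted form, and those of one path form an S_n-orbit. A suitable point of the orbit has the
  Young subgroup as stabiliser, so the functions on the orbit form the Young module; \<phi> collects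
  the coefficients along all orbits of degree k.\<close>

lemma slim_component_rep_iso_dyck:
  "res_rep (carrier (sym_group n)) (slim_component_rep n k) \<cong>\<^sub>r
     dsum_rep (sym_group n) {D. dyck_path n D \<and> area n D = k} (\<lambda>D. young_rep n (run_partition D))"
proof -
  define \<D> where "\<D> = {D. dyck_path n D \<and> area n D = k}"
  \<comment> \<open>The premise under the existential makes the statement total in D, so that one
    choice function \<alpha> serves all Dyck paths.\<close>
  have "\<exists>\<alpha>. dyck_path n D \<longrightarrow> mset (map \<alpha> [1..<n + 1]) = mset (columns 0 D) \<and>
      young_subgroup n (run_partition D) = {w. w permutes {1..n} \<and> (\<forall>i\<in>{1..n}. \<alpha> (w i) = \<alpha> i)}" for D
  proof (cases "dyck_path n D")
    case True
    then have "length (columns 0 D) = n"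
      by (simp add: dyck_path_iff_columns length_columns)
    then show ?thesis
      unfolding run_partition_eq_columns by (rule young_subgroup_stabilizer) blast
  qed simp
  then have "\<forall>D. \<exists>\<alpha>. dyck_path n D \<longrightarrow> mset (map \<alpha> [1..<n + 1]) = mset (columns 0 D) \<and>
      young_subgroup n (run_partition D) = {w. w permutes {1..n} \<and> (\<forall>i\<in>{1..n}. \<alpha> (w i) = \<alpha> i)}"
    by blast
  from choice[OF this] obtain \<alpha> where
    \<alpha>: "\<And>D. dyck_path n D \<Longrightarrow> mset (map (\<alpha> D) [1..<n + 1]) = mset (columns 0 D)" and
    stab: "\<And>D. dyck_path n D \<Longrightarrow> young_subgroup n (run_partition D) =
      {w. w permutes {1..n} \<and> (\<forall>i\<in>{1..n}. \<alpha> D (w i) = \<alpha> D i)}"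
    by blast
  \<comment> \<open>For a Dyck path D, \<open>e D x\<close> runs through the orbit of the filling
    \<open>\<alpha> D\<close> as x varies; it does not change when x is multiplied on the left by
    the Young subgroup.\<close>
  define e where "e = (\<lambda>D x. exp_of n (\<alpha> D \<circ> x))"
  have e_mset: "mset (map (lookup (e D x)) [1..<n + 1]) = mset (columns 0 D)"
    if "dyck_path n D" "x permutes {1..n}" for D x
    using that unfolding e_def map_lookup_exp_of mset_map_permute[OF that(2)] by (intro \<alpha>)
  have e_sort: "sort (map (lookup (e D x)) [1..<n + 1]) = columns 0 D"
    if "dyck_path n D" "x permutes {1..n}" for D x
    by (rule properties_for_sort[OF e_mset[OF that, symmetric] sorted_columns])
  have e_park: "e D x \<in> park_exp n" if D: "dyck_path n D" and x: "x permutes {1..n}" for D x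
    unfolding park_exp_iff_sort e_sort[OF D x]
    using D keys_exp_of[of n "\<alpha> D \<circ> x"] by (simp add: e_def dyck_path_iff_columns)
  have e_degree: "monom_degree (e D x) = area n D" if D: "dyck_path n D" and x: "x permutes {1..n}" for D x
  proof -
    have "monom_degree (e D x) = sum_list (map (lookup (e D x)) [1..<n + 1])"
      unfolding e_def by (intro monom_degree_exp keys_exp_of)
    also have "\<dots> = sum_list (columns 0 D)"
      using e_mset[OF D x] by (metis sum_mset_sum_list)
    finally show ?thesis
      using area_eq_sum_columns[OF D] by simp
  qed
  have e_surj: "\<exists>D x. dyck_path n D \<and> x permutes {1..n} \<and> a = e D x" if a: "a \<in> park_exp n" for a
  proof -
    have "\<forall>h<n. sort (map (lookup a) [1..<n + 1]) ! h \<le> h" and keys: "keys a \<subseteq> {1..n}"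
      using a unfolding park_exp_iff_sort by blast+
    then have "\<exists>D. dyck_path n D \<and> columns 0 D = sort (map (lookup a) [1..<n + 1])"
      by (intro ex_dyck_path) (simp_all del: upt_Suc)
    then obtain D where D: "dyck_path n D" "columns 0 D = sort (map (lookup a) [1..<n + 1])"
      by blast
    then have "mset (map (lookup a) [1..<n + 1]) = mset (map (\<alpha> D) [1..<n + 1])"
      using \<alpha>[OF D(1)] by simp
    moreover have "mset [1..<n + 1] = mset_set {1..n}"
      by (simp add: atLeastLessThanSuc_atLeastAtMost del: upt_Suc)
    ultimately have "image_mset (lookup a) (mset_set {1..n}) = image_mset (\<alpha> D) (mset_set {1..n})"
      by (metis mset_map)
    then obtain x where x: "x permutes {1..n}" "\<forall>i\<in>{1..n}. lookup a i = \<alpha> D (x i)"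
      using image_mset_eq_implies_permutes[of "{1..n}" "lookup a" "\<alpha> D"] by blast
    have "a = e D x"
    proof (rule poly_mapping_eqI)
      fix i
      have "lookup a i = 0" if "i \<notin> {1..n}"
        using keys that by (auto simp flip: not_in_keys_iff_lookup_eq_zero)
      then show "lookup a i = lookup (e D x) i"
        unfolding e_def lookup_exp_of using x by auto
    qed
    then show ?thesis using D x by blast
  qed
  \<comment> \<open>The sorted entries recover the column list and thus D. Agreement of
    \<open>\<alpha> D\<close> along x and x' puts x composed with the inverse of x' in the
    stabiliser.\<close>
  have e_inj: "D = D' \<and> (\<exists>h\<in>young_subgroup n (run_partition D). x = h \<circ> x')"
    if eq: "e D x = e D' x'" and D: "dyck_path n D" "dyck_path n D'"
      and x: "x permutes {1..n}" "x' permutes {1..n}" for D D' x x'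
  proof
    have "columns 0 D = columns 0 D'"
      using e_sort[OF D(1) x(1)] e_sort[OF D(2) x(2)] eq by simp
    then show "D = D'"
      using D path_of_columns_dyck by metis
    have "\<alpha> D (x i) = \<alpha> D (x' i)" if "i \<in> {1..n}" for i
      using arg_cong[OF eq, of "\<lambda>m. lookup m i"] that \<open>D = D'\<close> by (simp add: e_def)
    then have "\<alpha> D ((x \<circ> inv' x') i) = \<alpha> D i" if "i \<in> {1..n}" for i
      using that x permutes_inverses(1)[OF x(2)] permutes_in_image[OF permutes_inv[OF x(2)]]
      by (metis comp_apply)
    then have "x \<circ> inv' x' \<in> young_subgroup n (run_partition D)"
      using stab[OF D(1)] permutes_compose[OF permutes_inv[OF x(2)] x(1)] by blast
    moreover have "x = x \<circ> inv' x' \<circ> x'"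
      unfolding comp_assoc permutes_inv_o(2)[OF x(2)] by simp
    ultimately show "\<exists>h\<in>young_subgroup n (run_partition D). x = h \<circ> x'" by blast
  qed
  define \<phi> where "\<phi> = (\<lambda>(f :: cpoly) D x.
    if D \<in> \<D> \<and> x permutes {1..n} then lookup f (e D x) else (0 :: complex))"
  define S where "S = dsum_rep (sym_group n) \<D> (\<lambda>D. young_rep n (run_partition D))"
  have S: "rgroup S = sym_group n"
    "F \<in> rspace S \<longleftrightarrow> (\<forall>D\<in>\<D>. F D \<in> rspace (young_rep n (run_partition D))) \<and> (\<forall>D. D \<notin> \<D> \<longrightarrow> F D = 0)"
    "ract S g F = (\<lambda>D. if D \<in> \<D> then ract (young_rep n (run_partition D)) g (F D) else 0)" for F g
    by (simp_all add: S_def dsum_rep_def)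
  have "res_rep (carrier (sym_group n)) (slim_component_rep n k) \<cong>\<^sub>r S"
    unfolding slim_component_rep_def res_sym_group
  proof (rule rep_isoI[where \<phi> = \<phi>], simp_all only: rep.simps S(1))
    show "is_rep \<lparr>rgroup = sym_group n, rspace = slim_component n k, ract = permute_vars\<rparr>"
      by (intro permute_vars_is_rep subspace_slim_component permute_vars_slim_component permutes_Suc)
    show "is_rep S"
      unfolding S_def
      by (intro is_rep_dsum_rep sym_group_is_group is_rep_young_rep rgroup_young_rep)
    show "\<phi> (u + v) = \<phi> u + \<phi> v" for u v
      by (auto simp: \<phi>_def fun_eq_iff lookup_add)
    show "\<phi> (c *\<^sub>C v) = c *\<^sub>C \<phi> v" for c v
      by (auto simp: \<phi>_def fun_eq_iff scaleC_fun_def scaleC_complex_def)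
    show "\<phi> (permute_vars g v) = ract S g (\<phi> v)" if "g \<in> carrier (sym_group n)" for g v
    proof -
      have g: "g permutes {1..n}" using that by (simp add: sym_group_carrier)
      have "lookup (permute_vars g v) (e D x) = lookup v (e D (x \<circ> g))" for D x
        by (simp add: lookup_permute_vars permutes_bij[OF g] e_def push_inv_exp_of[OF g] comp_assoc)
      then show ?thesis
        using permutes_compose[OF g]
        by (auto simp: \<phi>_def S(3) ract_young_rep fun_eq_iff)
    qed
    show "bij_betw \<phi> (slim_component n k) (rspace S)"
    proof (rule bij_betwI')
      fix f g assume fg: "f \<in> slim_component n k" "g \<in> slim_component n k"
      show "\<phi> f = \<phi> g \<longleftrightarrow> f = g"
      proof
        assume eq: "\<phi> f = \<phi> g"
        have fg': "f - g \<in> slim_component n k"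
          using fg subspace_slim_component cvec.subspace_diff by blast
        have "lookup (f - g) a = 0" if "a \<in> park_exp n" for a
        proof (cases "monom_degree a = k")
          case True
          obtain D x where "dyck_path n D" "x permutes {1..n}" "a = e D x"
            using e_surj \<open>a \<in> park_exp n\<close> by blast
          moreover from this have "D \<in> \<D>"
            using True e_degree by (simp add: \<D>_def)
          ultimately show ?thesis
            using fun_cong[OF fun_cong[OF eq, of D], of x] by (simp add: \<phi>_def lookup_minus)
        next
          case False
          then show ?thesis
            using fg' by (simp add: slim_component_def homogeneous_iff_lookup)
        qed
        then have "f - g = 0"
          using fg' by (intro slim_space_eq_0[of _ n]) (auto simp: slim_component_def)
        then show "f = g" by simp
      qed simp
    next
      fix f
      show "\<phi> f \<in> rspace S"
        unfolding S(2) rspace_young_rep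
      proof (intro conjI ballI allI impI)
        fix D h x assume D: "D \<in> \<D>" and h: "h \<in> young_subgroup n (run_partition D)" and x: "x permutes {1..n}"
        have h: "h permutes {1..n}" "\<forall>i\<in>{1..n}. \<alpha> D (h i) = \<alpha> D i"
          using h D stab[of D] by (auto simp: \<D>_def)
        have "e D (h \<circ> x) = e D x"
          using h permutes_in_image[OF x] by (intro poly_mapping_eqI) (simp add: e_def)
        then show "\<phi> f D (h \<circ> x) = \<phi> f D x"
          using x permutes_compose[OF x h(1)] by (simp add: \<phi>_def)
      qed (auto simp: \<phi>_def)
    next
      fix F assume F: "F \<in> rspace S"
      \<comment> \<open>\<open>Q a p\<close> says that the pair p represents the exponent a. The
        values of F are carried to exponents through an arbitrary representative;
        \<open>e_inj\<close> and the invariance of F make the result independent of it.\<close>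
      define Q where "Q = (\<lambda>a (D, x). D \<in> \<D> \<and> x permutes {1..n} \<and> a = e D x)"
      define c where "c = (\<lambda>a. if \<exists>p. Q a p then case_prod F (SOME p. Q a p) else 0)"
      have c: "c (e D x) = F D x" if D: "D \<in> \<D>" and x: "x permutes {1..n}" for D x
      proof -
        have ex: "\<exists>p. Q (e D x) p"
          using D x by (auto simp: Q_def)
        obtain D' x' where p: "(SOME p. Q (e D x) p) = (D', x')" by fastforce
        then have Q: "D' \<in> \<D>" "x' permutes {1..n}" "e D x = e D' x'"
          using someI_ex[OF ex] by (auto simp: Q_def)
        have "D = D' \<and> (\<exists>h\<in>young_subgroup n (run_partition D). x = h \<circ> x')"
          using D Q x by (intro e_inj) (auto simp: \<D>_def)
        then obtain h where h: "D = D'" "h \<in> young_subgroup n (run_partition D)" "x = h \<circ> x'"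
          by blast
        have "F D \<in> rspace (young_rep n (run_partition D))"
          using F D unfolding S(2) by blast
        then have "F D (h \<circ> x') = F D x'"
          using h(2) Q(2) unfolding rspace_young_rep by blast
        then show ?thesis
          using ex p h by (simp add: c_def)
      qed
      \<comment> \<open>Exponents of other degrees have no representative, so c takes its default
        value 0, as \<open>slim_component_interpolate\<close> requires.\<close>
      have "c a = 0" if deg: "monom_degree a \<noteq> k" for a
      proof -
        have "\<not> Q a p" for p
          using e_degree deg by (auto simp: Q_def \<D>_def)
        then show ?thesis by (simp add: c_def)
      qed
      then obtain f where f: "f \<in> slim_component n k" "\<forall>a\<in>park_exp n. lookup f a = c a"
        using slim_component_interpolate[of k c n] by blast
      have "F D x = \<phi> f D x" for D x
      proof (cases "D \<in> \<D> \<and> x permutes {1..n}")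
        case True
        then have "e D x \<in> park_exp n"
          using e_park by (simp add: \<D>_def)
        then show ?thesis
          using True f(2) c by (simp add: \<phi>_def)
      next
        case False
        have "F D x = 0"
        proof (cases "D \<in> \<D>")
          case True
          then have "F D \<in> rspace (young_rep n (run_partition D))"
            using F unfolding S(2) by blast
          then show ?thesis
            using False True unfolding rspace_young_rep by blast
        next
          case False
          then have "F D = 0"
            using F unfolding S(2) by blast
          then show ?thesis by simp
        qed
        then show ?thesis
          using False by (auto simp: \<phi>_def)
      qed
      then have "F = \<phi> f" by blast
      then show "\<exists>f\<in>slim_component n k. F = \<phi> f"
        using f(1) by blast
    qed
  qed
  then show ?thesis
    by (simp add: S_def \<D>_def)
qed

theorem theorem1:
  fixes n :: nat
  assumes "n \<ge> 1"
  shows "is_rep (slim_rep n) \<and>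
    (\<forall>k. is_rep (slim_component_rep n k)) \<and>
    internal_direct_sum (slim_space n) (slim_component n) \<and>
    (\<forall>k. res_rep (carrier (sym_group n)) (slim_component_rep n k) \<cong>\<^sub>r
           dsum_rep (sym_group n) {D. dyck_path n D \<and> area n D = k}
             (\<lambda>D. young_rep n (run_partition D))) \<and>
    res_rep (carrier (sym_group n)) (slim_rep n) \<cong>\<^sub>r park_rep n"
  using is_rep_slim_rep is_rep_slim_component_rep slim_space_internal_direct_sum
    slim_component_rep_iso_dyck slim_rep_iso_park_rep by blast

end
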